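(* Let $1<p<2$, and let $(X_n)_{n\in\mathbb{Z}}$ be an adapted stationary sequence in $\mathbb{L}^p(\mathcal{H})$. Assume that $$\sum_{n\ge2}\log n\,\frac{\|\mathbb{E}_0(S_n)\|_{p,\mathcal{H}}}{n^{3/2}}<\infty .$$ Then there exists a stationary martingale $(M_n)_{n\ge1}$ in $\mathbb{L}^p(\mathcal{H})$ such that $|S_n-M_n|_{\mathcal{H}}=o(n^{1/p})$ $\mathbb{P}$-a.s. In particular, $|S_n|_{\mathcal{H}}=o(n^{1/p})$ $\mathbb{P}$-a.s.
   Context: Setting. $(\Omega,\mathcal{A},\mathbb{P})$ is a probability space and $\theta:\Omega\to\Omega$ is a bijective bi-measurable transformation preserving $\mathbb{P}$. $\mathcal{F}_0\subseteq\mathcal{A}$ is a $\sigma$-algebra with $\mathcal{F}_0\subseteq\theta^{-1}(\mathcal{F}_0)$, and $\mathcal{F}_i=\theta^{-i}(\mathcal{F}_0)$ for $i\in\mathbb{Z}$ (a nondecreasing filtration). $\mathcal{H}$ is a real separable Hilbert space with norm $|\cdot|_{\mathcal{H}}$, and $\|X\|_{p,\mathcal{H}}=(\mathbb{E}(|X|_{\mathcal{H}}^p))^{1/p}$. An adapted stationary sequence in $\mathbb{L}^p(\mathcal{H})$ is a sequence $X_i=X_0\circ\theta^i$, $i\in\mathbb{Z}$, where $X_0\in\mathbb{L}^p(\mathcal{H})$ is centered and $\mathcal{F}_0$-measurable. Notation: $S_n=X_1+\cdots+X_n$; $\mathbb{E}_k(X)=\mathbb{E}(X|\mathcal{F}_k)$.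 A stationary martingale in $\mathbb{L}^p(\mathcal{H})$ is a sequence $M_n=\sum_{k=1}^nD_k$ where $(D_k)$ is a stationary sequence of martingale differences in $\mathbb{L}^p(\mathcal{H})$ with respect to the filtration $(\mathcal{F}_k)$. *)

theory Defs
  imports "HOL-Probability.Probability" "HOL-Library.Landau_Symbols"
begin

text \<open>Real separable Hilbert spaces are rendered by the sort
  \<open>{real_inner, banach, second_countable_topology}\<close>; for metric spaces, separability and second
  countability coincide.\<close>

locale stationary_setting = prob_space M
  for M :: "'a measure" and \<theta> :: "'a \<Rightarrow> 'a" and F0 :: "'a measure" +
  assumes bij: "bij_betw \<theta> (space M) (space M)"
    and measurable_theta: "\<theta> \<in> M \<rightarrow>\<^sub>M M"
    and measurable_inverse: "inv_into (space M) \<theta> \<in> M \<rightarrow>\<^sub>M M"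
    and preserving: "distr M M \<theta> = M"
    and subalg: "subalgebra M F0"
    and F0_subset: "sets F0 \<subseteq> sets (vimage_algebra (space M) \<theta> F0)"

definition iterate :: "'a measure \<Rightarrow> ('a \<Rightarrow> 'a) \<Rightarrow> int \<Rightarrow> 'a \<Rightarrow> 'a" where
  "iterate M \<theta> i = (if 0 \<le> i then \<theta> ^^ nat i else inv_into (space M) \<theta> ^^ nat (- i))"

text \<open>The sigma-algebra \<open>\<theta>\<^sup>-\<^sup>i(F0)\<close>. Only the underlying set system of the measure
  space is relevant.\<close>

definition filt :: "'a measure \<Rightarrow> ('a \<Rightarrow> 'a) \<Rightarrow> 'a measure \<Rightarrow> int \<Rightarrow> 'a measure" where
  "filt M \<theta> F0 i = vimage_algebra (space M) (iterate M \<theta> i) F0"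

definition in_Lp ::
  "'a measure \<Rightarrow> real \<Rightarrow> ('a \<Rightarrow> 'h :: {real_inner, banach, second_countable_topology}) \<Rightarrow> bool" where
  "in_Lp M p X \<longleftrightarrow> X \<in> borel_measurable M \<and> integrable M (\<lambda>\<omega>. norm (X \<omega>) powr p)"

definition Lp_norm ::
  "'a measure \<Rightarrow> real \<Rightarrow> ('a \<Rightarrow> 'h :: {real_inner, banach, second_countable_topology}) \<Rightarrow> real" where
  "Lp_norm M p X = (\<integral>\<omega>. norm (X \<omega>) powr p \<partial>M) powr (1 / p)"

text \<open>The library's \<open>real_cond_exp\<close> covers real-valued functions only, so the Hilbert-valued
  conditional expectation is introduced through its defining property, with Bochner integrals.\<close>

definition is_cond_exp ::
  "'a measure \<Rightarrow> 'a measure \<Rightarrow> ('a \<Rightarrow> 'h :: {real_inner, banach, second_countable_topology})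
     \<Rightarrow> ('a \<Rightarrow> 'h) \<Rightarrow> bool" where
  "is_cond_exp M F X Y \<longleftrightarrow>
     integrable M X \<and> integrable M Y \<and> Y \<in> borel_measurable F \<and>
     (\<forall>A\<in>sets F. set_lebesgue_integral M A Y = set_lebesgue_integral M A X)"

text \<open>For integrable \<open>X\<close> and a sub-sigma-algebra \<open>F\<close> such a version exists and is unique
  up to null sets; the value 0 is a convention for non-integrable \<open>X\<close>.\<close>

definition cond_exp ::
  "'a measure \<Rightarrow> 'a measure \<Rightarrow> ('a \<Rightarrow> 'h :: {real_inner, banach, second_countable_topology})
     \<Rightarrow> 'a \<Rightarrow> 'h" where
  "cond_exp M F X =
     (if \<exists>Y. is_cond_exp M F X Y then (SOME Y. is_cond_exp M F X Y) else (\<lambda>_. 0))"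

definition adapted_stationary_seq ::
  "'a measure \<Rightarrow> ('a \<Rightarrow> 'a) \<Rightarrow> 'a measure \<Rightarrow> real
     \<Rightarrow> (int \<Rightarrow> 'a \<Rightarrow> 'h :: {real_inner, banach, second_countable_topology}) \<Rightarrow> bool" where
  "adapted_stationary_seq M \<theta> F0 p X \<longleftrightarrow>
     in_Lp M p (X 0) \<and> X 0 \<in> borel_measurable F0 \<and> (\<integral>\<omega>. X 0 \<omega> \<partial>M) = 0 \<and>
     (\<forall>i. \<forall>\<omega>\<in>space M. X i \<omega> = X 0 (iterate M \<theta> i \<omega>))"

definition stationary_mart_diff ::
  "'a measure \<Rightarrow> ('a \<Rightarrow> 'a) \<Rightarrow> 'a measure \<Rightarrow> real
     \<Rightarrow> (int \<Rightarrow> 'a \<Rightarrow> 'h :: {real_inner, banach, second_countable_topology}) \<Rightarrow> bool" where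
  "stationary_mart_diff M \<theta> F0 p D \<longleftrightarrow>
     adapted_stationary_seq M \<theta> F0 p D \<and>
     (\<forall>k. AE \<omega> in M. cond_exp M (filt M \<theta> F0 (k - 1)) (D k) \<omega> = 0)"

definition partial_sum :: "(int \<Rightarrow> 'a \<Rightarrow> 'h :: real_normed_vector) \<Rightarrow> nat \<Rightarrow> 'a \<Rightarrow> 'h" where
  "partial_sum X n \<omega> = (\<Sum>k=1..n. X (int k) \<omega>)"

definition stationary_martingale ::
  "'a measure \<Rightarrow> ('a \<Rightarrow> 'a) \<Rightarrow> 'a measure \<Rightarrow> real
     \<Rightarrow> (nat \<Rightarrow> 'a \<Rightarrow> 'h :: {real_inner, banach, second_countable_topology}) \<Rightarrow> bool" where
  "stationary_martingale M \<theta> F0 p Mart \<longleftrightarrow>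
     (\<exists>D. stationary_mart_diff M \<theta> F0 p D \<and>
       (\<forall>n\<ge>1. \<forall>\<omega>\<in>space M. Mart n \<omega> = partial_sum D n \<omega>))"

end

theory Submission
  imports Defs
begin

text \<open>By the Marcinkiewicz-Zygmund strong law a stationary martingale in \<open>L\<^sup>p\<close> is itself \<open>o(n\<^bsup>1/p\<^esup>)\<close>
  almost surely, so the two claims are equivalent and the approximating martingale may be taken to
  be 0. It remains to show that \<open>S\<^sub>n\<close> is \<open>o(n\<^bsup>1/p\<^esup>)\<close>.

  Since the norms \<open>V n\<close> of \<open>E\<^sub>0(S\<^sub>n)\<close> are subadditive up to a constant, comparing \<open>V n\<close> with
  \<open>V k + V (n - k)\<close> and averaging over \<open>k\<close> turns the summability hypothesis into \<open>V n = O(n\<^bsup>1/2\<^esup>)\<close>.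
  Conditioning dyadic blocks on their past decomposes \<open>S\<^sub>n\<close> into martingales, one for each block
  length \<open>2\<^sup>j\<close>, with about \<open>n / 2\<^sup>j\<close> increments of \<open>L\<^sup>p\<close>-norm \<open>O(2\<^bsup>j/2\<^esup>)\<close>. Each of them is
  \<open>o(n\<^bsup>1/p\<^esup>)\<close> by truncation and Doob's inequality, and the corresponding weak-type maximal
  inequality shows that level \<open>j\<close> contributes at most \<open>C \<rho>\<^sup>j n\<^bsup>1/p\<^esup>\<close> for all large \<open>j\<close>, where
  \<open>\<rho> < 1\<close> because \<open>1/2 < 1/p\<close>. Tannery's theorem then allows to sum over the levels.\<close>

section \<open>Conditional expectations in Hilbert spaces\<close>

text \<open>The heuristics behind the scales: a martingale with N identically distributed increments
  of \<open>L^p\<close>-norm s is of size at most about s N^(1/p), so level j contributes 2^(j/2) (n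
  / 2^j)^(1/p) = n^(1/p) 2^(-j (1/p - 1/2)). The obstacle is that the number of levels grows with n,
  while a strong law at each single level gives nothing uniform in j. Hence the maximal inequality
  has to hold for all times at once: it yields one exceptional event per level, with probabilities
  summable in j, and Borel-Cantelli then gives a bound valid for all n once j is large. Half of the
  gap 1/p - 1/2 pays for the summability of these probabilities, the other half for \<rho> < 1. As p
  < 2, second moments may be infinite; truncating the k-th increment at a multiple of (k + 1)^(1/p)
  makes them finite, and the cost of truncation sums over k to a multiple of the p-th moment. The
  normalisation is put inside the sum and removed again by summation by parts, as in Kronecker's
  lemma.\<close>

lemma convex_on_abs_powr:
  fixes p :: real
  assumes "1 \<le> p"
  shows "convex_on UNIV (\<lambda>x. \<bar>x\<bar> powr p)"
proof -
  have conv: "((1 - u) * x + u * y) powr p \<le> (1 - u) * x powr p + u * y powr p"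
    if "0 < u" "u < 1" "0 \<le> x" "0 \<le> y" for u x y :: real
  \<comment> \<open>At the endpoint 0 convexity amounts to t^p \<le> t for 0 < t < 1; away from it
    \<open>powr_convex\<close> applies.\<close>
  proof (cases "x = 0 \<or> y = 0")
    case True
    have small: "t powr p \<le> t" if "0 < t" "t < 1" for t :: real
      using powr_mono'[of 1 p t] assms that by simp
    have "(t * z) powr p \<le> t * z powr p" if "0 < t" "t < 1" "0 \<le> z" for t z :: real
      using mult_right_mono[OF small[OF that(1,2)], of "z powr p"] that by (simp add: powr_mult)
    with True that show ?thesis by (auto simp: assms)
  next
    case False
    with that convex_onD[OF powr_convex[OF assms], of u x y] show ?thesis by simp
  qed
  show ?thesis
  proof (rule convex_onI)
    fix t x y :: real
    assume t: "0 < t" "t < 1"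
    have "\<bar>(1 - t) *\<^sub>R x + t *\<^sub>R y\<bar> \<le> (1 - t) * \<bar>x\<bar> + t * \<bar>y\<bar>"
      using t abs_triangle_ineq[of "(1 - t) * x" "t * y"] by (simp add: abs_mult)
    then have "\<bar>(1 - t) *\<^sub>R x + t *\<^sub>R y\<bar> powr p \<le> ((1 - t) * \<bar>x\<bar> + t * \<bar>y\<bar>) powr p"
      using assms by (intro powr_mono2) auto
    also have "\<dots> \<le> (1 - t) * \<bar>x\<bar> powr p + t * \<bar>y\<bar> powr p"
      by (rule conv) (use t in auto)
    finally show "\<bar>(1 - t) *\<^sub>R x + t *\<^sub>R y\<bar> powr p \<le> (1 - t) * \<bar>x\<bar> powr p + t * \<bar>y\<bar> powr p" .
  qed simp
qed

text \<open>The violated inequality is an open condition on the test vector, so a violation at y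
  itself would spread to a point of \<open>D\<close>. A countable \<open>D\<close> then allows to
  collect the null sets of all test vectors.\<close>

lemma norm_leI_inner_dense:
  fixes y :: "'h :: real_inner"
  assumes dense: "\<And>U :: 'h set. open U \<Longrightarrow> U \<noteq> {} \<Longrightarrow> \<exists>d\<in>D. d \<in> U"
    and le: "\<And>d. d \<in> D \<Longrightarrow> inner y d \<le> c * norm d"
    and c: "0 \<le> c"
  shows "norm y \<le> c"
proof -
  have "inner y y \<le> c * norm y"
  proof (rule ccontr)
    assume "\<not> ?thesis"
    then have "y \<in> {x. c * norm x < inner y x}" by simp
    moreover have "open {x. c * norm x < inner y x}"
      by (intro open_Collect_less continuous_intros)
    ultimately obtain d where "d \<in> D" "c * norm d < inner y d"
      using dense[of "{x. c * norm x < inner y x}"] by blast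
    with le[of d] show False by simp
  qed
  then have "norm y * norm y \<le> c * norm y"
    by (simp add: power2_norm_eq_inner[symmetric] power2_eq_square)
  with c show ?thesis
    by (cases "norm y = 0") (auto simp: mult_le_cancel_right)
qed

lemma is_cond_exp_add:
  assumes sub: "subalgebra M F" and XY: "is_cond_exp M F X Y" "is_cond_exp M F X' Y'"
  shows "is_cond_exp M F (\<lambda>\<omega>. X \<omega> + X' \<omega>) (\<lambda>\<omega>. Y \<omega> + Y' \<omega>)"
proof -
  have A: "A \<in> sets M" if "A \<in> sets F" for A
    using that sub by (auto simp: subalgebra_def)
  have int: "set_integrable M A Z" if "A \<in> sets F" "integrable M Z" for A and Z :: "'a \<Rightarrow> 'b"
    unfolding set_integrable_def using that A by (intro integrable_mult_indicator) auto
  show ?thesis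
    using XY int unfolding is_cond_exp_def by (auto simp: set_integral_add)
qed

lemma is_cond_exp_bounded_linear:
  fixes T :: "'h :: {real_inner, banach, second_countable_topology} \<Rightarrow>
    'k :: {real_inner, banach, second_countable_topology}"
  assumes sub: "subalgebra M F" and T: "bounded_linear T" and XY: "is_cond_exp M F X Y"
  shows "is_cond_exp M F (\<lambda>\<omega>. T (X \<omega>)) (\<lambda>\<omega>. T (Y \<omega>))"
proof -
  interpret T: bounded_linear T by (rule T)
  have A: "A \<in> sets M" if "A \<in> sets F" for A
    using that sub by (auto simp: subalgebra_def)
  have eq: "set_lebesgue_integral M A (\<lambda>\<omega>. T (Z \<omega>)) = T (set_lebesgue_integral M A Z)"
    if "A \<in> sets F" "integrable M Z" for A and Z :: "'a \<Rightarrow> 'h"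
  proof -
    have "integrable M (\<lambda>\<omega>. indicator A \<omega> *\<^sub>R Z \<omega>)"
      using that A by (intro integrable_mult_indicator) auto
    from integral_bounded_linear[OF T this] show ?thesis
      by (simp add: set_lebesgue_integral_def T.scaleR)
  qed
  have [measurable]: "T \<in> borel_measurable borel"
    by (intro borel_measurable_continuous_onI T.continuous_on continuous_on_id)
  show ?thesis
    using XY integrable_bounded_linear[OF T] unfolding is_cond_exp_def by (auto simp: eq)
qed

lemma is_cond_exp_diff:
  assumes sub: "subalgebra M F" and XY: "is_cond_exp M F X Y" "is_cond_exp M F X' Y'"
  shows "is_cond_exp M F (\<lambda>\<omega>. X \<omega> - X' \<omega>) (\<lambda>\<omega>. Y \<omega> - Y' \<omega>)"
  using is_cond_exp_add[OF sub XY(1) is_cond_exp_bounded_linear[OF sub _ XY(2)], of uminus]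
  by (simp add: bounded_linear_minus bounded_linear_ident)

lemma is_cond_exp_cong_sets:
  assumes "space F = space F'" "sets F = sets F'"
  shows "is_cond_exp M F X Y \<longleftrightarrow> is_cond_exp M F' X Y"
  using assms by (simp add: is_cond_exp_def measurable_cong_sets[OF assms(2) refl])

lemma is_cond_exp_cong:
  assumes "\<And>\<omega>. \<omega> \<in> space M \<Longrightarrow> X \<omega> = X' \<omega>"
  shows "is_cond_exp M F X Y \<longleftrightarrow> is_cond_exp M F X' Y"
proof -
  have "integrable M X \<longleftrightarrow> integrable M X'"
    by (rule Bochner_Integration.integrable_cong) (use assms in auto)
  moreover have "set_lebesgue_integral M A X = set_lebesgue_integral M A X'" for A
    unfolding set_lebesgue_integral_def by (rule Bochner_Integration.integral_cong) (use assms in auto)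
  ultimately show ?thesis by (simp add: is_cond_exp_def)
qed

lemma is_cond_exp_tower:
  assumes "is_cond_exp M F X Z" "is_cond_exp M G X Y" "sets F \<subseteq> sets G"
  shows "is_cond_exp M F Y Z"
  using assms by (auto simp: is_cond_exp_def subset_iff)

context prob_space
begin

lemma sigma_finite_subalgebraI:
  assumes "subalgebra M F"
  shows "sigma_finite_subalgebra M F"
proof -
  interpret finite_measure_subalgebra M F
    using assms by unfold_locales
  show ?thesis by unfold_locales
qed

text \<open>Pairing with a fixed vector turns \<open>Y\<close> into a real conditional expectation,
  which Cauchy-Schwarz bounds by that of the norm. Countably many vectors determine the norm, so one
  null set is enough.\<close>

lemma AE_norm_is_cond_exp_le:
  fixes X :: "'a \<Rightarrow> 'h :: {real_inner, banach, second_countable_topology}"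
  assumes sub: "subalgebra M F" and XY: "is_cond_exp M F X Y"
  shows "AE \<omega> in M. norm (Y \<omega>) \<le> real_cond_exp M F (\<lambda>\<omega>. norm (X \<omega>)) \<omega>"
proof -
  interpret sigma_finite_subalgebra M F
    by (rule sigma_finite_subalgebraI[OF sub])
  from XY have int: "integrable M X" "integrable M Y" by (auto simp: is_cond_exp_def)
  then have [measurable]: "X \<in> borel_measurable M" "Y \<in> borel_measurable M" by auto
  obtain D :: "'h set" where D: "countable D"
    and dense: "\<And>U. open U \<Longrightarrow> U \<noteq> {} \<Longrightarrow> \<exists>d\<in>D. d \<in> U"
    using countable_dense_setE by blast
  have "AE \<omega> in M. inner (Y \<omega>) d \<le> real_cond_exp M F (\<lambda>\<omega>. norm (X \<omega>)) \<omega> * norm d" for d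
  proof -
    have bl: "bounded_linear (\<lambda>x. inner x d)" by (rule bounded_linear_inner_left)
    have "is_cond_exp M F (\<lambda>\<omega>. inner (X \<omega>) d) (\<lambda>\<omega>. inner (Y \<omega>) d)"
      by (rule is_cond_exp_bounded_linear[OF sub bl XY])
    then have "AE \<omega> in M. real_cond_exp M F (\<lambda>\<omega>. inner (X \<omega>) d) \<omega> = inner (Y \<omega>) d"
      unfolding is_cond_exp_def by (intro real_cond_exp_charact) auto
    moreover have "AE \<omega> in M. real_cond_exp M F (\<lambda>\<omega>. inner (X \<omega>) d) \<omega>
        \<le> real_cond_exp M F (\<lambda>\<omega>. norm d * norm (X \<omega>)) \<omega>"
      using int norm_cauchy_schwarz[of _ d]
      by (intro real_cond_exp_mono) (auto intro!: integrable_bounded_linear[OF bl] AE_I2 simp: mult.commute[of "norm d"])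
    moreover have "AE \<omega> in M. real_cond_exp M F (\<lambda>\<omega>. norm d * norm (X \<omega>)) \<omega>
        = norm d * real_cond_exp M F (\<lambda>\<omega>. norm (X \<omega>)) \<omega>"
      using int by (intro real_cond_exp_cmult) auto
    ultimately show ?thesis by eventually_elim (simp add: mult.commute)
  qed
  then have "AE \<omega> in M. \<forall>d\<in>D. inner (Y \<omega>) d \<le> real_cond_exp M F (\<lambda>\<omega>. norm (X \<omega>)) \<omega> * norm d"
    by (simp add: AE_ball_countable[OF D])
  moreover have "AE \<omega> in M. real_cond_exp M F (\<lambda>\<omega>. norm (X \<omega>)) \<omega> \<ge> 0"
    by (intro real_cond_exp_pos) auto
  ultimately show ?thesis
    by eventually_elim (auto intro: norm_leI_inner_dense[OF dense])
qed

text \<open>Once the norm of \<open>Y\<close> is dominated by the conditional expectation of the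
  norm of \<open>X\<close>, this is conditional Jensen for a real function.\<close>

lemma is_cond_exp_Lp:
  fixes X :: "'a \<Rightarrow> 'h :: {real_inner, banach, second_countable_topology}"
  assumes sub: "subalgebra M F" and XY: "is_cond_exp M F X Y" and p: "1 \<le> p"
    and X: "integrable M (\<lambda>\<omega>. norm (X \<omega>) powr p)"
  shows "integrable M (\<lambda>\<omega>. norm (Y \<omega>) powr p)"
    and "(\<integral>\<omega>. norm (Y \<omega>) powr p \<partial>M) \<le> (\<integral>\<omega>. norm (X \<omega>) powr p \<partial>M)"
proof -
  interpret sigma_finite_subalgebra M F
    by (rule sigma_finite_subalgebraI[OF sub])
  from XY have int: "integrable M X" "integrable M Y" by (auto simp: is_cond_exp_def)
  then have [measurable]: "X \<in> borel_measurable M" "Y \<in> borel_measurable M" by auto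
  have X': "integrable M (\<lambda>\<omega>. \<bar>norm (X \<omega>)\<bar> powr p)" using X by simp
  have "AE \<omega> in M. \<bar>real_cond_exp M F (\<lambda>\<omega>. norm (X \<omega>)) \<omega>\<bar> powr p
      \<le> real_cond_exp M F (\<lambda>\<omega>. \<bar>norm (X \<omega>)\<bar> powr p) \<omega>"
    by (rule real_cond_exp_jensens_inequality(2)[where I = UNIV])
      (use int X p in \<open>auto intro: convex_on_abs_powr\<close>)
  with AE_norm_is_cond_exp_le[OF sub XY]
  have le: "AE \<omega> in M. norm (Y \<omega>) powr p \<le> real_cond_exp M F (\<lambda>\<omega>. norm (X \<omega>) powr p) \<omega>"
  proof eventually_elim
    case (elim \<omega>)
    then have "norm (Y \<omega>) powr p \<le> \<bar>real_cond_exp M F (\<lambda>\<omega>. norm (X \<omega>)) \<omega>\<bar> powr p"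
      using p by (intro powr_mono2) auto
    with elim show ?case by simp
  qed
  have R: "integrable M (real_cond_exp M F (\<lambda>\<omega>. norm (X \<omega>) powr p))"
    using X by (rule real_cond_exp_int)
  show *: "integrable M (\<lambda>\<omega>. norm (Y \<omega>) powr p)"
    by (rule Bochner_Integration.integrable_bound[OF R]) (use le in auto)
  have "(\<integral>\<omega>. norm (Y \<omega>) powr p \<partial>M) \<le> (\<integral>\<omega>. real_cond_exp M F (\<lambda>\<omega>. norm (X \<omega>) powr p) \<omega> \<partial>M)"
    by (rule integral_mono_AE[OF * R le])
  also have "\<dots> = (\<integral>\<omega>. norm (X \<omega>) powr p \<partial>M)"
    using X by (rule real_cond_exp_int)
  finally show "(\<integral>\<omega>. norm (Y \<omega>) powr p \<partial>M) \<le> (\<integral>\<omega>. norm (X \<omega>) powr p \<partial>M)" .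
qed

lemma integral_norm_is_cond_exp_le:
  fixes X :: "'a \<Rightarrow> 'h :: {real_inner, banach, second_countable_topology}"
  assumes sub: "subalgebra M F" and XY: "is_cond_exp M F X Y"
  shows "(\<integral>\<omega>. norm (Y \<omega>) \<partial>M) \<le> (\<integral>\<omega>. norm (X \<omega>) \<partial>M)"
  using is_cond_exp_Lp(2)[OF sub XY, of 1] XY by (simp add: is_cond_exp_def)

text \<open>For indicators times a vector the real conditional expectation is available. In the
  limit step the \<open>L^1\<close> contraction makes the versions of a fast subsequence an
  absolutely convergent telescoping series.\<close>

lemma is_cond_exp_exists:
  fixes X :: "'a \<Rightarrow> 'h :: {real_inner, banach, second_countable_topology}"
  assumes sub: "subalgebra M F" and X: "integrable M X"
  shows "\<exists>Y. is_cond_exp M F X Y"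
  using X
proof (induct rule: integrable_induct)
  case (base A c)
  interpret sigma_finite_subalgebra M F
    by (rule sigma_finite_subalgebraI[OF sub])
  have int: "integrable M (indicator A :: 'a \<Rightarrow> real)"
    using base by simp
  have AF: "B \<in> sets M" if "B \<in> sets F" for B
    using that sub by (auto simp: subalgebra_def)
  have "is_cond_exp M F (indicator A :: 'a \<Rightarrow> real) (real_cond_exp M F (indicator A))"
    using int unfolding is_cond_exp_def
    by (auto intro: real_cond_exp_int real_cond_exp_intA[symmetric])
  from is_cond_exp_bounded_linear[OF sub bounded_linear_scaleR_left this] show ?case
    by blast
next
  case (add f g)
  then show ?case using is_cond_exp_add[OF sub] by blast
next
  case (lim f s)
  have AF: "B \<in> sets M" if "B \<in> sets F" for B
    using that sub by (auto simp: subalgebra_def)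
  have [measurable]: "f \<in> borel_measurable M" "\<And>i. s i \<in> borel_measurable M"
    using lim(1,5) by auto
  obtain Z where Z: "\<And>i. is_cond_exp M F (s i) (Z i)"
    using lim(2) by metis
  have "(\<lambda>i. \<integral>\<omega>. norm (s i \<omega> - f \<omega>) \<partial>M) \<longlonglongrightarrow> (\<integral>\<omega>. 0 \<partial>M)"
  proof (rule integral_dominated_convergence[where w = "\<lambda>\<omega>. 3 * norm (f \<omega>)"])
    show "AE \<omega> in M. (\<lambda>i. norm (s i \<omega> - f \<omega>)) \<longlonglongrightarrow> 0"
      using lim(3) by (intro AE_I2) (simp add: LIM_zero tendsto_norm_zero)
    show "AE \<omega> in M. norm (norm (s i \<omega> - f \<omega>)) \<le> 3 * norm (f \<omega>)" for i
    proof (intro AE_I2)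
      fix \<omega> assume "\<omega> \<in> space M"
      then show "norm (norm (s i \<omega> - f \<omega>)) \<le> 3 * norm (f \<omega>)"
        using lim(4)[of \<omega> i] norm_triangle_ineq4[of "s i \<omega>" "f \<omega>"] by simp
    qed
  qed (use lim(5) in auto)
  then have conv: "(\<lambda>i. \<integral>\<omega>. norm (s i \<omega> - f \<omega>) \<partial>M) \<longlonglongrightarrow> 0" by simp
  have "\<exists>i. (\<integral>\<omega>. norm (s i \<omega> - f \<omega>) \<partial>M) < (1/2)^k" for k :: nat
    using order_tendstoD(2)[OF conv, of "(1/2)^k"] by (auto simp: eventually_sequentially)
  then obtain r where r: "\<And>k. (\<integral>\<omega>. norm (s (r k) \<omega> - f \<omega>) \<partial>M) < (1/2)^k"
    by metis
  define g where "g k \<omega> = Z (r (Suc k)) \<omega> - Z (r k) \<omega>" for k \<omega>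
  \<comment> \<open>The series converges only almost everywhere. \<open>suminf\<close> still gives a
    function measurable for \<open>F\<close> on the whole space, so no exceptional set has to be
    removed.\<close>
  define Y where "Y \<omega> = Z (r 0) \<omega> + (\<Sum>k. g k \<omega>)" for \<omega>
  have gc: "is_cond_exp M F (\<lambda>\<omega>. s (r (Suc k)) \<omega> - s (r k) \<omega>) (g k)" for k
    unfolding g_def by (rule is_cond_exp_diff[OF sub Z Z])
  then have int_g: "integrable M (g k)" and meas_g[measurable]: "g k \<in> borel_measurable F" for k
    by (auto simp: is_cond_exp_def)
  have int_Z: "integrable M (Z i)" and meas_Z[measurable]: "Z i \<in> borel_measurable F" for i
    using Z[of i] by (auto simp: is_cond_exp_def)
  have g_le: "(\<integral>\<omega>. norm (g k \<omega>) \<partial>M) \<le> 2 * (1/2)^k" for k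
  proof -
    have "(\<integral>\<omega>. norm (g k \<omega>) \<partial>M) \<le> (\<integral>\<omega>. norm (s (r (Suc k)) \<omega> - s (r k) \<omega>) \<partial>M)"
      by (rule integral_norm_is_cond_exp_le[OF sub gc])
    also have "\<dots> \<le> (\<integral>\<omega>. norm (s (r (Suc k)) \<omega> - f \<omega>) + norm (s (r k) \<omega> - f \<omega>) \<partial>M)"
    proof (intro integral_mono)
      fix \<omega>
      show "norm (s (r (Suc k)) \<omega> - s (r k) \<omega>) \<le> norm (s (r (Suc k)) \<omega> - f \<omega>) + norm (s (r k) \<omega> - f \<omega>)"
        using norm_triangle_ineq4[of "s (r (Suc k)) \<omega> - f \<omega>" "s (r k) \<omega> - f \<omega>"] by simp
    qed (use lim(1,5) in auto)
    also have "\<dots> = (\<integral>\<omega>. norm (s (r (Suc k)) \<omega> - f \<omega>) \<partial>M) + (\<integral>\<omega>. norm (s (r k) \<omega> - f \<omega>) \<partial>M)"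
      using lim(1,5) by (intro Bochner_Integration.integral_add) auto
    also have "\<dots> \<le> 2 * (1/2)^k"
      using r[of k] r[of "Suc k"] zero_le_power[of "1/2::real" k] unfolding power_Suc by linarith
    finally show ?thesis .
  qed
  have sum_g: "summable (\<lambda>k. \<integral>\<omega>. norm (g k \<omega>) \<partial>M)"
    by (rule summable_comparison_test'[where g = "\<lambda>k. 2 * (1/2)^k" and N = 0])
      (use g_le in \<open>auto intro!: summable_mult summable_geometric\<close>)
  have AE_sum: "AE \<omega> in M. summable (\<lambda>k. norm (g k \<omega>))"
  proof -
    have "(\<integral>\<^sup>+\<omega>. (\<Sum>k. ennreal (norm (g k \<omega>))) \<partial>M) = (\<Sum>k. \<integral>\<^sup>+\<omega>. ennreal (norm (g k \<omega>)) \<partial>M)"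
      using int_g by (intro nn_integral_suminf) auto
    also have "\<dots> = (\<Sum>k. ennreal (\<integral>\<omega>. norm (g k \<omega>) \<partial>M))"
      using int_g by (intro suminf_cong nn_integral_eq_integral) auto
    also have "\<dots> \<noteq> \<infinity>"
      using sum_g by (simp add: ennreal_suminf_neq_top)
    finally have "AE \<omega> in M. (\<Sum>k. ennreal (norm (g k \<omega>))) \<noteq> \<infinity>"
      using int_g by (intro nn_integral_PInf_AE) auto
    then show ?thesis
      by eventually_elim (auto intro: summable_suminf_not_top)
  qed
  have tele: "Z (r 0) \<omega> + (\<Sum>k<n. g k \<omega>) = Z (r n) \<omega>" for n \<omega>
    unfolding g_def using sum_lessThan_telescope[of "\<lambda>k. Z (r k) \<omega>" n] by simp
  have intA: "integrable M (\<lambda>\<omega>. indicator A \<omega> *\<^sub>R h \<omega>)" if "integrable M h" "A \<in> sets F"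
    for A and h :: "'a \<Rightarrow> 'h"
    using that AF by (intro integrable_mult_indicator) auto
  have "is_cond_exp M F f Y"
    unfolding is_cond_exp_def
  proof (intro conjI ballI)
    show "integrable M f" by fact
    show "integrable M Y"
      unfolding Y_def by (intro Bochner_Integration.integrable_add int_Z integrable_suminf int_g AE_sum sum_g)
    show "Y \<in> borel_measurable F"
      unfolding Y_def by measurable
    fix A assume A: "A \<in> sets F"
    have A_g: "(\<integral>\<omega>. norm (indicator A \<omega> *\<^sub>R g k \<omega>) \<partial>M) \<le> (\<integral>\<omega>. norm (g k \<omega>) \<partial>M)" for k
      by (intro integral_mono integrable_norm intA int_g A) (simp add: indicator_def)
    have "(\<lambda>k. \<integral>\<omega>. indicator A \<omega> *\<^sub>R g k \<omega> \<partial>M) sums (\<integral>\<omega>. (\<Sum>k. indicator A \<omega> *\<^sub>R g k \<omega>) \<partial>M)"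
    proof (rule sums_integral[OF intA[OF int_g A]])
      show "AE \<omega> in M. summable (\<lambda>k. norm (indicator A \<omega> *\<^sub>R g k \<omega>))"
        using AE_sum by eventually_elim (auto simp: indicator_def)
      show "summable (\<lambda>k. \<integral>\<omega>. norm (indicator A \<omega> *\<^sub>R g k \<omega>) \<partial>M)"
        by (rule summable_comparison_test'[OF sum_g, where N = 0]) (use A_g in auto)
    qed
    also have "(\<integral>\<omega>. (\<Sum>k. indicator A \<omega> *\<^sub>R g k \<omega>) \<partial>M) = (\<integral>\<omega>. indicator A \<omega> *\<^sub>R (\<Sum>k. g k \<omega>) \<partial>M)"
      by (intro Bochner_Integration.integral_cong) (auto simp: indicator_def)
    also have "\<dots> = set_lebesgue_integral M A Y - set_lebesgue_integral M A (Z (r 0))"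
      unfolding set_lebesgue_integral_def Y_def scaleR_add_right
      by (subst Bochner_Integration.integral_add)
        (use intA[OF _ A] int_Z int_g AE_sum sum_g in \<open>auto intro!: integrable_suminf\<close>)
    finally have "(\<lambda>n. set_lebesgue_integral M A (Z (r 0)) + (\<Sum>k<n. \<integral>\<omega>. indicator A \<omega> *\<^sub>R g k \<omega> \<partial>M))
        \<longlonglongrightarrow> set_lebesgue_integral M A (Z (r 0)) + (set_lebesgue_integral M A Y - set_lebesgue_integral M A (Z (r 0)))"
      unfolding sums_def by (intro tendsto_add tendsto_const)
    moreover have "set_lebesgue_integral M A (Z (r 0)) + (\<Sum>k<n. \<integral>\<omega>. indicator A \<omega> *\<^sub>R g k \<omega> \<partial>M)
        = set_lebesgue_integral M A (s (r n))" for n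
    proof -
      have "set_lebesgue_integral M A (Z (r 0)) + (\<Sum>k<n. \<integral>\<omega>. indicator A \<omega> *\<^sub>R g k \<omega> \<partial>M)
          = set_lebesgue_integral M A (Z (r n))"
        unfolding set_lebesgue_integral_def tele[of _ n, symmetric] scaleR_add_right scaleR_sum_right
        by (subst Bochner_Integration.integral_add)
          (intro intA int_Z int_g A Bochner_Integration.integrable_sum |
           subst Bochner_Integration.integral_sum, rule intA[OF int_g A], rule refl)+
      also have "\<dots> = set_lebesgue_integral M A (s (r n))"
        using Z A by (auto simp: is_cond_exp_def)
      finally show ?thesis .
    qed
    ultimately have lim1: "(\<lambda>n. set_lebesgue_integral M A (s (r n))) \<longlonglongrightarrow> set_lebesgue_integral M A Y"
      by simp
    have "(\<lambda>n. set_lebesgue_integral M A (s (r n)) - set_lebesgue_integral M A f) \<longlonglongrightarrow> 0"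
    proof (rule Lim_null_comparison[OF always_eventually])
      show "\<forall>n. norm (set_lebesgue_integral M A (s (r n)) - set_lebesgue_integral M A f) \<le> (1/2)^n"
      proof
        fix n
        have "set_lebesgue_integral M A (s (r n)) - set_lebesgue_integral M A f
            = (\<integral>\<omega>. indicator A \<omega> *\<^sub>R (s (r n) \<omega> - f \<omega>) \<partial>M)"
          using intA[OF _ A] lim(1,5) unfolding set_lebesgue_integral_def scaleR_diff_right by simp
        also have "norm \<dots> \<le> (\<integral>\<omega>. norm (indicator A \<omega> *\<^sub>R (s (r n) \<omega> - f \<omega>)) \<partial>M)"
          by (rule integral_norm_bound)
        also have "\<dots> \<le> (\<integral>\<omega>. norm (s (r n) \<omega> - f \<omega>) \<partial>M)"
          by (intro integral_mono integrable_norm intA A Bochner_Integration.integrable_diff lim)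
            (simp add: indicator_def)
        also have "\<dots> \<le> (1/2)^n" using r[of n] by simp
        finally show "norm (set_lebesgue_integral M A (s (r n)) - set_lebesgue_integral M A f) \<le> (1/2)^n" .
      qed
      show "(\<lambda>n. (1/2)^n :: real) \<longlonglongrightarrow> 0" by (rule LIMSEQ_power_zero) simp
    qed
    then have "(\<lambda>n. set_lebesgue_integral M A (s (r n))) \<longlonglongrightarrow> set_lebesgue_integral M A f"
      by (simp add: LIM_zero_iff)
    with lim1 show "set_lebesgue_integral M A Y = set_lebesgue_integral M A f"
      by (rule LIMSEQ_unique)
  qed
  then show ?case by blast
qed

lemma is_cond_exp_cond_exp:
  fixes X :: "'a \<Rightarrow> 'h :: {real_inner, banach, second_countable_topology}"
  assumes "subalgebra M F" "integrable M X"
  shows "is_cond_exp M F X (cond_exp M F X)"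
  using is_cond_exp_exists[OF assms] by (simp add: cond_exp_def someI_ex)

end

section \<open>A maximal inequality for Hilbert-valued martingales\<close>

context prob_space
begin

text \<open>A simple function for \<open>F\<close> is constant on finitely many sets of
  \<open>F\<close>, over each of which \<open>d\<close> integrates to 0. The general case follows by
  dominated convergence, with approximants bounded by 2 \<open>norm (H \<omega>)\<close>.\<close>

lemma integral_inner_eq_0:
  fixes d H :: "'a \<Rightarrow> 'h :: {real_inner, banach, second_countable_topology}"
  assumes sub: "subalgebra M F" and d0: "is_cond_exp M F d (\<lambda>_. 0)"
    and H[measurable]: "H \<in> borel_measurable F"
    and int: "integrable M (\<lambda>\<omega>. norm (H \<omega>) * norm (d \<omega>))"
  shows "(\<integral>\<omega>. inner (H \<omega>) (d \<omega>) \<partial>M) = 0"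
proof -
  have sp: "space F = space M" using sub by (simp add: subalgebra_def)
  have HM[measurable]: "H \<in> borel_measurable M" by (rule measurable_from_subalg[OF sub H])
  have d: "integrable M d" and d0': "set_lebesgue_integral M A d = 0" if "A \<in> sets F" for A
    using d0 that by (auto simp: is_cond_exp_def set_lebesgue_integral_def)
  have d: "integrable M d" using d0 by (simp add: is_cond_exp_def)
  then have [measurable]: "d \<in> borel_measurable M" by auto
  have AF: "B \<in> sets M" if "B \<in> sets F" for B
    using that sub by (auto simp: subalgebra_def)
  have "\<exists>s. (\<forall>i. simple_function F (s i)) \<and> (\<forall>x\<in>space F. (\<lambda>i. s i x) \<longlonglongrightarrow> H x) \<and>
      (\<forall>i. \<forall>x\<in>space F. norm (s i x) \<le> 2 * norm (H x))"
    using borel_measurable_implies_sequence_metric[OF H, of 0] by (simp add: dist_norm)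
  then obtain s where s: "\<And>i. simple_function F (s i)" "\<And>x. x \<in> space F \<Longrightarrow> (\<lambda>i. s i x) \<longlonglongrightarrow> H x"
    "\<And>i x. x \<in> space F \<Longrightarrow> norm (s i x) \<le> 2 * norm (H x)"
    by blast
  have s_meas[measurable]: "s i \<in> borel_measurable M" for i
    by (rule measurable_from_subalg[OF sub borel_measurable_simple_function[OF s(1)]])
  have "(\<integral>\<omega>. inner (s i \<omega>) (d \<omega>) \<partial>M) = 0" for i
  proof -
    have fin: "finite (s i ` space M)" using s(1)[of i] by (simp add: simple_function_def sp)
    have A: "s i -` {x} \<inter> space M \<in> sets F" for x
      using simple_functionD(2)[OF s(1), of i "{x}"] by (simp add: sp)
    have int1: "integrable M (\<lambda>\<omega>. indicator (s i -` {x} \<inter> space M) \<omega> *\<^sub>R d \<omega>)" for x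
      using AF[OF A] d by (intro integrable_mult_indicator) auto
    have "(\<integral>\<omega>. inner (s i \<omega>) (d \<omega>) \<partial>M)
        = (\<integral>\<omega>. (\<Sum>x\<in>s i ` space M. inner x (indicator (s i -` {x} \<inter> space M) \<omega> *\<^sub>R d \<omega>)) \<partial>M)"
    proof (intro Bochner_Integration.integral_cong refl)
      fix \<omega> assume \<omega>: "\<omega> \<in> space M"
      have "(\<Sum>x\<in>s i ` space M. inner x (indicator (s i -` {x} \<inter> space M) \<omega> *\<^sub>R d \<omega>))
          = (\<Sum>x\<in>s i ` space M. if x = s i \<omega> then inner (s i \<omega>) (d \<omega>) else 0)"
        using \<omega> by (intro sum.cong) (auto simp: indicator_def)
      also have "\<dots> = inner (s i \<omega>) (d \<omega>)"
        using \<omega> fin by simp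
      finally show "inner (s i \<omega>) (d \<omega>)
          = (\<Sum>x\<in>s i ` space M. inner x (indicator (s i -` {x} \<inter> space M) \<omega> *\<^sub>R d \<omega>))" by simp
    qed
    also have "\<dots> = (\<Sum>x\<in>s i ` space M. inner x (\<integral>\<omega>. indicator (s i -` {x} \<inter> space M) \<omega> *\<^sub>R d \<omega> \<partial>M))"
      using int1 by (simp only: Bochner_Integration.integral_sum integrable_inner_right integral_inner_right)
    also have "\<dots> = 0"
      using d0'[OF A] by (simp add: set_lebesgue_integral_def)
    finally show ?thesis .
  qed
  moreover have "(\<lambda>i. \<integral>\<omega>. inner (s i \<omega>) (d \<omega>) \<partial>M) \<longlonglongrightarrow> (\<integral>\<omega>. inner (H \<omega>) (d \<omega>) \<partial>M)"
  proof (rule integral_dominated_convergence[where w = "\<lambda>\<omega>. 2 * (norm (H \<omega>) * norm (d \<omega>))"])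
    show "AE \<omega> in M. (\<lambda>i. inner (s i \<omega>) (d \<omega>)) \<longlonglongrightarrow> inner (H \<omega>) (d \<omega>)"
      using s(2) by (intro AE_I2 tendsto_inner) (auto simp: sp)
    show "AE \<omega> in M. norm (inner (s i \<omega>) (d \<omega>)) \<le> 2 * (norm (H \<omega>) * norm (d \<omega>))" for i
    proof (intro AE_I2)
      fix \<omega> assume "\<omega> \<in> space M"
      then have "norm (s i \<omega>) * norm (d \<omega>) \<le> 2 * norm (H \<omega>) * norm (d \<omega>)"
        using s(3)[of \<omega> i] by (intro mult_right_mono) (auto simp: sp)
      with Cauchy_Schwarz_ineq2[of "s i \<omega>" "d \<omega>"]
      show "norm (inner (s i \<omega>) (d \<omega>)) \<le> 2 * (norm (H \<omega>) * norm (d \<omega>))" by simp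
    qed
  qed (use int in auto)
  ultimately show ?thesis by (simp add: LIMSEQ_const_iff)
qed

lemma (in -) integrable_norm_mult_norm:
  fixes f g :: "'a \<Rightarrow> 'h :: {real_inner, banach, second_countable_topology}"
  assumes [measurable]: "f \<in> borel_measurable M" "g \<in> borel_measurable M"
    and int: "integrable M (\<lambda>\<omega>. (norm (f \<omega>))\<^sup>2)" "integrable M (\<lambda>\<omega>. (norm (g \<omega>))\<^sup>2)"
  shows "integrable M (\<lambda>\<omega>. norm (f \<omega>) * norm (g \<omega>))"
proof (rule Bochner_Integration.integrable_bound)
  show "integrable M (\<lambda>\<omega>. (norm (f \<omega>))\<^sup>2 + (norm (g \<omega>))\<^sup>2)" using int by simp
  show "AE \<omega> in M. norm (norm (f \<omega>) * norm (g \<omega>)) \<le> norm ((norm (f \<omega>))\<^sup>2 + (norm (g \<omega>))\<^sup>2)"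
  proof (intro AE_I2)
    fix \<omega>
    have "2 * norm (f \<omega>) * norm (g \<omega>) \<le> (norm (f \<omega>))\<^sup>2 + (norm (g \<omega>))\<^sup>2"
      by (rule sum_squares_bound)
    moreover have "0 \<le> norm (f \<omega>) * norm (g \<omega>)" by simp
    ultimately show "norm (norm (f \<omega>) * norm (g \<omega>)) \<le> norm ((norm (f \<omega>))\<^sup>2 + (norm (g \<omega>))\<^sup>2)"
      unfolding real_norm_def by linarith
  qed
qed simp

lemma (in -) norm_add_sq: "(norm (x + y))\<^sup>2 = (norm x)\<^sup>2 + 2 * inner x y + (norm y)\<^sup>2"
  for x y :: "'h :: real_inner"
  by (simp add: power2_norm_eq_inner inner_add inner_commute)

text \<open>Orthogonality of increments: the sum over k < n is measurable for \<open>G n\<close>,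
  while \<open>d n\<close> is centered given \<open>G n\<close>, so the cross term vanishes. In this
  indexing \<open>d k\<close> becomes known at time k + 1.\<close>

lemma martingale_diff_sum_sq:
  fixes d :: "nat \<Rightarrow> 'a \<Rightarrow> 'h :: {real_inner, banach, second_countable_topology}"
  assumes sub: "\<And>k. subalgebra M (G k)" and mono: "\<And>k l. k \<le> l \<Longrightarrow> sets (G k) \<subseteq> sets (G l)"
    and meas: "\<And>k. d k \<in> borel_measurable (G (Suc k))"
    and d0: "\<And>k. is_cond_exp M (G k) (d k) (\<lambda>_. 0)"
    and sq: "\<And>k. integrable M (\<lambda>\<omega>. (norm (d k \<omega>))\<^sup>2)"
  shows "integrable M (\<lambda>\<omega>. (norm (\<Sum>k<n. d k \<omega>))\<^sup>2) \<and>
    (\<integral>\<omega>. (norm (\<Sum>k<n. d k \<omega>))\<^sup>2 \<partial>M) = (\<Sum>k<n. \<integral>\<omega>. (norm (d k \<omega>))\<^sup>2 \<partial>M)"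
proof (induction n)
  case (Suc n)
  let ?S = "\<lambda>\<omega>. \<Sum>k<n. d k \<omega>"
  have dG: "d k \<in> borel_measurable (G n)" if "k < n" for k
    using meas[of k] mono[of "Suc k" n] that sub
    by (auto intro!: measurable_from_subalg[of "G n"] simp: subalgebra_def)
  have SG: "?S \<in> borel_measurable (G n)"
    by (intro borel_measurable_sum) (use dG in auto)
  have [measurable]: "?S \<in> borel_measurable M" by (rule measurable_from_subalg[OF sub SG])
  have [measurable]: "d n \<in> borel_measurable M" by (rule measurable_from_subalg[OF sub meas])
  have int: "integrable M (\<lambda>\<omega>. norm (?S \<omega>) * norm (d n \<omega>))"
    using Suc sq by (intro integrable_norm_mult_norm) auto
  then have int2: "integrable M (\<lambda>\<omega>. inner (?S \<omega>) (d n \<omega>))"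
    by (rule Bochner_Integration.integrable_bound) (auto simp: Cauchy_Schwarz_ineq2)
  have 0: "(\<integral>\<omega>. inner (?S \<omega>) (d n \<omega>) \<partial>M) = 0"
    by (rule integral_inner_eq_0[OF sub d0 SG int])
  show ?case
    using Suc int2 sq[of n] 0 by (simp add: norm_add_sq)
qed simp

lemma (in -) is_cond_exp_indicator:
  fixes d :: "'a \<Rightarrow> 'h :: {real_inner, banach, second_countable_topology}"
  assumes sub: "subalgebra M F" and d: "is_cond_exp M F d (\<lambda>_. 0)" and B: "B \<in> sets F"
  shows "is_cond_exp M F (\<lambda>\<omega>. indicator B \<omega> *\<^sub>R d \<omega>) (\<lambda>_. 0)"
proof -
  have BM: "B \<in> sets M" using B sub by (auto simp: subalgebra_def)
  have "set_lebesgue_integral M A (\<lambda>\<omega>. indicator B \<omega> *\<^sub>R d \<omega>) = set_lebesgue_integral M (A \<inter> B) d" for A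
    unfolding set_lebesgue_integral_def
    by (intro Bochner_Integration.integral_cong) (auto simp: indicator_def)
  with d B BM show ?thesis
    by (auto simp: is_cond_exp_def set_lebesgue_integral_def intro!: integrable_mult_indicator)
qed

text \<open>Stopping the martingale at the first passage reduces the maximal inequality to Chebyshev's
  inequality for a single index.\<close>

lemma martingale_maximal_finite:
  fixes d :: "nat \<Rightarrow> 'a \<Rightarrow> 'h :: {real_inner, banach, second_countable_topology}"
  assumes sub: "\<And>k. subalgebra M (G k)" and mono: "\<And>k l. k \<le> l \<Longrightarrow> sets (G k) \<subseteq> sets (G l)"
    and meas: "\<And>k. d k \<in> borel_measurable (G (Suc k))"
    and d0: "\<And>k. is_cond_exp M (G k) (d k) (\<lambda>_. 0)"
    and sq: "\<And>k. integrable M (\<lambda>\<omega>. (norm (d k \<omega>))\<^sup>2)"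
  shows "prob {\<omega>\<in>space M. \<exists>m\<le>n. 1 < norm (\<Sum>k<m. d k \<omega>)} \<le> (\<Sum>k<n. \<integral>\<omega>. (norm (d k \<omega>))\<^sup>2 \<partial>M)"
proof -
  have sp: "space (G k) = space M" for k using sub by (simp add: subalgebra_def)
  \<comment> \<open>\<open>B k\<close> is the event of no passage up to and including index k,
    exactly when the k-th increment is kept. It lies in \<open>G k\<close>, so the stopped
    increments \<open>e k\<close> remain centered given \<open>G k\<close>.\<close>
  define B where "B k = {\<omega>\<in>space M. \<forall>m\<le>k. norm (\<Sum>i<m. d i \<omega>) \<le> 1}" for k
  define e where "e k \<omega> = indicator (B k) \<omega> *\<^sub>R d k \<omega>" for k \<omega>
  have dG: "d k \<in> borel_measurable (G n)" if "k < n" for k n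
    using meas[of k] mono[of "Suc k" n] that sub
    by (auto intro!: measurable_from_subalg[of "G n"] simp: subalgebra_def)
  have B: "B k \<in> sets (G k)" for k
  proof -
    have S: "(\<lambda>\<omega>. \<Sum>i<m. d i \<omega>) \<in> borel_measurable (G k)" if "m \<le> k" for m
      by (intro borel_measurable_sum) (use dG that in auto)
    have *: "{\<omega>\<in>space (G k). norm (\<Sum>i<m. d i \<omega>) \<le> 1} \<in> sets (G k)" if "m \<le> k" for m
      by (rule borel_measurable_le[OF measurable_compose[OF S[OF that] borel_measurable_norm] borel_measurable_const])
    have "{\<omega>\<in>space (G k). \<forall>m\<in>{..k}. norm (\<Sum>i<m. d i \<omega>) \<le> 1} \<in> sets (G k)"
    proof (rule sets.sets_Collect_finite_All)
      fix m assume "m \<in> {..k}"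
      then show "{\<omega>\<in>space (G k). norm (\<Sum>i<m. d i \<omega>) \<le> 1} \<in> sets (G k)"
        using *[of m] by simp
    qed simp
    then show ?thesis unfolding B_def sp Ball_def atMost_iff .
  qed
  have BM: "B k \<in> sets M" for k using B sub by (auto simp: subalgebra_def)
  have dM[measurable]: "d k \<in> borel_measurable M" for k by (rule measurable_from_subalg[OF sub meas])
  have BS: "B k \<in> sets (G (Suc k))" for k using B[of k] mono[of k "Suc k"] by auto
  have eG: "e k \<in> borel_measurable (G (Suc k))" for k
    unfolding e_def using meas[of k] BS[of k] by measurable
  have e0: "is_cond_exp M (G k) (e k) (\<lambda>_. 0)" for k
    unfolding e_def by (rule is_cond_exp_indicator[OF sub d0 B])
  have e_sq_eq: "(norm (e k \<omega>))\<^sup>2 = indicator (B k) \<omega> *\<^sub>R (norm (d k \<omega>))\<^sup>2" for k \<omega>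
    by (simp add: e_def indicator_def)
  have e_sq: "integrable M (\<lambda>\<omega>. (norm (e k \<omega>))\<^sup>2)" for k
    unfolding e_sq_eq by (intro integrable_mult_indicator BM sq)
  have e_le: "(\<integral>\<omega>. (norm (e k \<omega>))\<^sup>2 \<partial>M) \<le> (\<integral>\<omega>. (norm (d k \<omega>))\<^sup>2 \<partial>M)" for k
    using sq e_sq by (intro integral_mono) (auto simp: e_def indicator_def)
  note E = martingale_diff_sum_sq[of G e, OF sub mono eG e0 e_sq, of n]
  have stop: "1 < norm (\<Sum>k<n. e k \<omega>)" if \<omega>: "\<omega> \<in> space M" and ex: "\<exists>m\<le>n. 1 < norm (\<Sum>k<m. d k \<omega>)" for \<omega>
  proof -
    define m where "m = (LEAST m. 1 < norm (\<Sum>k<m. d k \<omega>))"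
    from ex obtain m' where m': "m' \<le> n" "1 < norm (\<Sum>k<m'. d k \<omega>)" by blast
    have m: "1 < norm (\<Sum>k<m. d k \<omega>)" unfolding m_def by (rule LeastI[of _ m']) (rule m')
    have "m \<le> m'" unfolding m_def by (rule Least_le) (rule m')
    with m' have "m \<le> n" by simp
    have before: "norm (\<Sum>k<l. d k \<omega>) \<le> 1" if "l < m" for l
      using not_less_Least[of l "\<lambda>m. 1 < norm (\<Sum>k<m. d k \<omega>)"] that unfolding m_def by auto
    have e1: "e k \<omega> = d k \<omega>" if "k < m" for k
      using before that \<omega> by (auto simp: e_def B_def indicator_def)
    have e2: "e k \<omega> = 0" if "m \<le> k" for k
      using m that by (auto simp: e_def B_def indicator_def not_le)
    have "(\<Sum>k<n. e k \<omega>) = (\<Sum>k<m. e k \<omega>)"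
      by (rule sum.mono_neutral_right) (use \<open>m \<le> n\<close> e2 in auto)
    also have "\<dots> = (\<Sum>k<m. d k \<omega>)" using e1 by simp
    finally show ?thesis using m by simp
  qed
  have eM[measurable]: "e k \<in> borel_measurable M" for k by (rule measurable_from_subalg[OF sub eG])
  have "prob {\<omega>\<in>space M. \<exists>m\<le>n. 1 < norm (\<Sum>k<m. d k \<omega>)}
      \<le> prob {\<omega>\<in>space M. 1 \<le> (norm (\<Sum>k<n. e k \<omega>))\<^sup>2}"
    using stop by (intro finite_measure_mono) (force simp: one_le_power less_imp_le, measurable)
  also have "\<dots> \<le> (\<integral>\<omega>. (norm (\<Sum>k<n. e k \<omega>))\<^sup>2 \<partial>M) / 1"
    using E by (intro integral_Markov_inequality_measure[where A = "{}"]) auto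
  also have "\<dots> \<le> (\<Sum>k<n. \<integral>\<omega>. (norm (d k \<omega>))\<^sup>2 \<partial>M)"
    using E e_le by (auto intro: sum_mono)
  finally show ?thesis .
qed

end

section \<open>Truncated moments\<close>

text \<open>Summation by parts, the quantitative core of Kronecker's lemma. One \<delta>
  \<open>c m\<close> comes from the boundary term, the other from the increments of
  \<open>c\<close>, which telescope to at most \<open>c m\<close>.\<close>

lemma abel_norm_sum_le:
  fixes w :: "nat \<Rightarrow> 'b :: real_normed_vector"
  assumes c: "incseq c" "0 \<le> c 0" and s: "\<And>l. l \<le> m \<Longrightarrow> norm (\<Sum>k<l. w k) \<le> \<delta>"
  shows "norm (\<Sum>k<m. c k *\<^sub>R w k) \<le> 2 * \<delta> * c m"
proof -
  let ?s = "\<lambda>l. \<Sum>k<l. w k"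
  have step: "0 \<le> c (Suc k) - c k" for k
    using incseq_SucD[OF c(1), of k] by simp
  have cm: "0 \<le> c m" using c incseqD[OF c(1), of 0 m] by simp
  have \<delta>: "0 \<le> \<delta>" using s[of 0] by simp
  have "(\<Sum>k<n. c k *\<^sub>R w k) = c n *\<^sub>R ?s n - (\<Sum>k<n. (c (Suc k) - c k) *\<^sub>R ?s (Suc k))" for n
    by (induction n) (simp_all add: algebra_simps)
  then have "norm (\<Sum>k<m. c k *\<^sub>R w k)
      \<le> norm (c m *\<^sub>R ?s m) + norm (\<Sum>k<m. (c (Suc k) - c k) *\<^sub>R ?s (Suc k))"
    using norm_triangle_ineq4 by metis
  also have "norm (\<Sum>k<m. (c (Suc k) - c k) *\<^sub>R ?s (Suc k)) \<le> (\<Sum>k<m. (c (Suc k) - c k) * \<delta>)"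
    using s step by (intro sum_norm_le) (auto simp: simp del: sum.lessThan_Suc intro!: mult_left_mono)
  also have "\<dots> = (c m - c 0) * \<delta>"
    by (simp add: sum_distrib_right[symmetric] sum_lessThan_telescope)
  also have "(c m - c 0) * \<delta> \<le> c m * \<delta>"
    using c(2) \<delta> by (intro mult_right_mono) auto
  also have "norm (c m *\<^sub>R ?s m) \<le> c m * \<delta>"
    using s[of m] cm by (auto intro: mult_left_mono)
  finally show ?thesis by simp
qed

text \<open>Mean value theorem, the derivative of y^e being e times a decreasing power. The exponent
  e may be negative: positive e serves the divergent sums of powers, negative e the tails of the
  convergent ones.\<close>

lemma powr_step:
  fixes y e :: real
  assumes "0 < y" "e < 1" "e \<noteq> 0"
  shows "(y + 1) powr (e - 1) \<le> ((y + 1) powr e - y powr e) / e"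
proof -
  have "\<exists>z. y < z \<and> z < y + 1 \<and> (y + 1) powr e - y powr e = (y + 1 - y) * (e * z powr (e - 1))"
    using assms by (intro MVT2) (auto intro!: derivative_eq_intros)
  then obtain z where z: "y < z" "z < y + 1" "(y + 1) powr e - y powr e = e * z powr (e - 1)"
    by auto
  have "(y + 1) powr (e - 1) \<le> z powr (e - 1)"
    using z assms by (intro powr_mono2') auto
  with z assms show ?thesis by simp
qed

lemma sum_powr_head_le:
  fixes a :: real
  assumes a: "0 < a" "a < 1"
  shows "(\<Sum>k<m. real (Suc k) powr (a - 1)) \<le> real m powr a / a"
proof (induction m)
  case (Suc m)
  have "real (Suc m) powr (a - 1) \<le> (real (Suc m) powr a - real m powr a) / a"
  proof (cases "m = 0")
    case False
    then show ?thesis using powr_step[of "real m" a] a by (simp add: add.commute)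
  qed (use a in auto)
  with Suc show ?case by (simp add: diff_divide_distrib)
qed simp

lemma sum_powr_tail_le:
  fixes c :: real
  assumes c: "0 < c"
  shows "(\<Sum>k\<in>{K..<n}. real (Suc k) powr (- c - 1)) \<le> (1 + 1 / c) * real (Suc K) powr (- c)"
proof (cases "K < n")
  case True
  \<comment> \<open>The term with index \<open>K\<close> is kept apart, because for \<open>K\<close>
    = 0 the interval of \<open>powr_step\<close> would begin at 0. It produces the 1 in 1 + 1 /
    c.\<close>
  have "(\<Sum>k\<in>{Suc K..<n}. real (Suc k) powr (- c - 1)) \<le> (real (Suc K) powr (- c) - real n powr (- c)) / c"
    if "K < n" for n
    using that
  proof (induction n)
    case (Suc n)
    show ?case
    proof (cases "K = n")
      case False
      with Suc have "K < n" by simp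
      have "real (Suc n) powr (- c - 1) \<le> (real n powr (- c) - real (Suc n) powr (- c)) / c"
        using powr_step[of "real n" "- c"] c \<open>K < n\<close> by (simp add: add.commute diff_divide_distrib)
      with Suc.IH[OF \<open>K < n\<close>] \<open>K < n\<close> show ?thesis by (simp add: diff_divide_distrib)
    qed simp
  qed simp
  from this[OF True] have "(\<Sum>k\<in>{Suc K..<n}. real (Suc k) powr (- c - 1)) \<le> real (Suc K) powr (- c) / c"
    using c by (smt (verit) divide_right_mono powr_ge_zero)
  moreover have "real (Suc K) powr (- c - 1) \<le> real (Suc K) powr (- c)"
    by (intro powr_mono) auto
  ultimately show ?thesis
    using True by (simp add: sum.atLeast_Suc_lessThan algebra_simps)
next
  case False
  then show ?thesis using c by simp
qed

text \<open>The expected cost of truncating a centered increment of norm x at 1. For x \<le> 1, four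
  times the square bounds the second moment of the truncated part after centering. For x > 1, one x
  pays for the event that truncation takes place and the other for the \<open>L^1\<close>-norm of
  the part removed.\<close>

definition trunc_moment :: "real \<Rightarrow> real" where
  "trunc_moment x = (if x \<le> 1 then 4 * x\<^sup>2 else 2 * x)"

lemma trunc_moment_nonneg: "0 \<le> x \<Longrightarrow> 0 \<le> trunc_moment x"
  by (simp add: trunc_moment_def)

lemma trunc_moment_le: "0 \<le> x \<Longrightarrow> trunc_moment x \<le> 4 * x"
  by (auto simp: trunc_moment_def power2_eq_square mult_left_le)

lemma trunc_moment_0 [simp]: "trunc_moment 0 = 0"
  by (simp add: trunc_moment_def)

lemma borel_measurable_trunc_moment [measurable]: "trunc_moment \<in> borel_measurable borel"
  unfolding trunc_moment_def[abs_def] by measurable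

text \<open>The two summands come from the two branches of \<open>trunc_moment\<close>; 1 - 1/p and
  2/p - 1 are the exponents of the power sums that arise there, positive because 1 < p and p <
  2.\<close>

definition trunc_const :: "real \<Rightarrow> real" where
  "trunc_const p = 2 / (1 - 1 / p) + 4 * (1 + 1 / (2 / p - 1))"

text \<open>The weight k^(1/p) passes x at k = T = x^p. Before T the terms are 2 x k^(-1/p) and add
  up to order x T^(1 - 1/p) = x^p; from T on they are 4 x^2 k^(-2/p) and add up to order x^2 T^(1 -
  2/p) = x^p as well.\<close>

lemma sum_trunc_moment_le:
  fixes p x :: real
  assumes p: "1 < p" "p < 2" and x: "0 \<le> x"
  shows "(\<Sum>k<n. trunc_moment (x / real (Suc k) powr (1 / p))) \<le> trunc_const p * x powr p"
proof -
  define a where "a = 1 - 1 / p"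
  define c where "c = 2 / p - 1"
  have a: "0 < a" "a < 1" and c: "0 < c" using p by (auto simp: a_def c_def field_simps)
  show ?thesis
  proof (cases "x = 0")
    case False
    with x have x: "0 < x" by simp
    define T where "T = x powr p"
    have T: "0 < T" using x by (simp add: T_def)
    have Tp: "T powr (1 / p) = x" using p x by (simp add: T_def powr_powr)
    define I where "I = {k\<in>{..<n}. real (Suc k) < T}"
    define J where "J = {k\<in>{..<n}. T \<le> real (Suc k)}"
    have tmI: "trunc_moment (x / real (Suc k) powr (1 / p)) = 2 * x * real (Suc k) powr (a - 1)" if "k \<in> I" for k
    proof -
      have "real (Suc k) powr (1 / p) < T powr (1 / p)"
        using that p by (intro powr_less_mono2) (auto simp: I_def)
      then have "1 < x / real (Suc k) powr (1 / p)"
        by (simp add: Tp)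
      then show ?thesis
        by (simp add: trunc_moment_def a_def powr_minus_divide)
    qed
    have tmJ: "trunc_moment (x / real (Suc k) powr (1 / p)) = 4 * x\<^sup>2 * real (Suc k) powr (- c - 1)" if "k \<in> J" for k
    proof -
      have "T powr (1 / p) \<le> real (Suc k) powr (1 / p)"
        using that p T by (intro powr_mono2) (auto simp: J_def)
      then have "x / real (Suc k) powr (1 / p) \<le> 1"
        by (simp add: Tp)
      moreover have "(real (Suc k) powr (1 / p))\<^sup>2 = real (Suc k) powr (2 / p)"
        by (simp add: power2_eq_square powr_add[symmetric])
      ultimately show ?thesis
        by (simp add: trunc_moment_def c_def powr_minus_divide power_divide)
    qed
    have "(\<Sum>k\<in>I. real (Suc k) powr (a - 1)) \<le> (\<Sum>k<nat \<lfloor>T\<rfloor>. real (Suc k) powr (a - 1))"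
      by (intro sum_mono2) (auto simp: I_def, linarith)
    also have "\<dots> \<le> real (nat \<lfloor>T\<rfloor>) powr a / a" by (rule sum_powr_head_le[OF a])
    also have "\<dots> \<le> T powr a / a"
      using T a by (intro divide_right_mono powr_mono2) auto
    finally have I: "(\<Sum>k\<in>I. real (Suc k) powr (a - 1)) \<le> T powr a / a" .
    have xI: "x * T powr a = x powr p"
    proof -
      have "x * T powr a = x powr 1 * x powr (p * a)" using x by (simp add: T_def powr_powr)
      also have "\<dots> = x powr (1 + p * a)" by (simp only: powr_add)
      also have "1 + p * a = p" using p by (simp add: a_def field_simps)
      finally show ?thesis .
    qed
    \<comment> \<open>The first index with T \<le> \<open>Suc K\<close>. As T is positive, its
      ceiling is at least 1 and the natural subtraction is exact.\<close>
    define K where "K = nat \<lceil>T\<rceil> - 1"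
    have K: "T \<le> real (Suc K)" unfolding K_def using T by linarith
    have "(\<Sum>k\<in>J. real (Suc k) powr (- c - 1)) \<le> (\<Sum>k\<in>{K..<n}. real (Suc k) powr (- c - 1))"
      by (intro sum_mono2) (auto simp: J_def K_def, linarith)
    also have "\<dots> \<le> (1 + 1 / c) * real (Suc K) powr (- c)" by (rule sum_powr_tail_le[OF c])
    also have "\<dots> \<le> (1 + 1 / c) * T powr (- c)"
      using T K c by (intro mult_left_mono powr_mono2') auto
    finally have J: "(\<Sum>k\<in>J. real (Suc k) powr (- c - 1)) \<le> (1 + 1 / c) * T powr (- c)" .
    have xJ: "x\<^sup>2 * T powr (- c) = x powr p"
    proof -
      have "x\<^sup>2 * T powr (- c) = x powr 2 * x powr (p * (- c))" using x by (simp add: T_def powr_powr)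
      also have "\<dots> = x powr (2 + p * (- c))" by (simp only: powr_add)
      also have "2 + p * (- c) = p" using p by (simp add: c_def field_simps)
      finally show ?thesis .
    qed
    have split: "{..<n} = I \<union> J" "I \<inter> J = {}" "finite I" "finite J"
      by (auto simp: I_def J_def)
    have "(\<Sum>k<n. trunc_moment (x / real (Suc k) powr (1 / p)))
        = (\<Sum>k\<in>I. 2 * x * real (Suc k) powr (a - 1)) + (\<Sum>k\<in>J. 4 * x\<^sup>2 * real (Suc k) powr (- c - 1))"
      unfolding split(1) using split tmI tmJ by (simp only: sum.union_disjoint cong: sum.cong)
    also have "\<dots> = 2 * x * (\<Sum>k\<in>I. real (Suc k) powr (a - 1)) + 4 * x\<^sup>2 * (\<Sum>k\<in>J. real (Suc k) powr (- c - 1))"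
      by (simp only: sum_distrib_left)
    also have "\<dots> \<le> 2 * x * (T powr a / a) + 4 * x\<^sup>2 * ((1 + 1 / c) * T powr (- c))"
      using x I J by (intro add_mono mult_left_mono) auto
    also have "\<dots> = 2 * (x * T powr a) / a + 4 * (1 + 1 / c) * (x\<^sup>2 * T powr (- c))"
      by (simp only: ac_simps times_divide_eq_right times_divide_eq_left)
    also have "\<dots> = trunc_const p * x powr p"
      unfolding xI xJ trunc_const_def a_def[symmetric] c_def[symmetric] by (simp add: algebra_simps)
    finally show ?thesis .
  qed simp
qed

lemma trunc_const_nonneg: "1 < p \<Longrightarrow> p < 2 \<Longrightarrow> 0 \<le> trunc_const p"
  unfolding trunc_const_def by (intro add_nonneg_nonneg mult_nonneg_nonneg divide_nonneg_nonneg) (auto simp: field_simps)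

section \<open>Strong laws for centered identically distributed adapted sequences\<close>

context prob_space
begin

lemma (in -) is_cond_exp_self:
  fixes Y :: "'a \<Rightarrow> 'h :: {real_inner, banach, second_countable_topology}"
  assumes "integrable M Y" "Y \<in> borel_measurable F"
  shows "is_cond_exp M F Y Y"
  using assms by (simp add: is_cond_exp_def)

lemma
  fixes Z :: "'a \<Rightarrow> 'h :: {real_inner, banach, second_countable_topology}"
  assumes Z: "integrable M Z"
  shows integrable_trunc_moment_norm: "integrable M (\<lambda>\<omega>. trunc_moment (norm (Z \<omega>)))"
    and prob_norm_gt_1_le: "prob {\<omega>\<in>space M. 1 < norm (Z \<omega>)} \<le> (\<integral>\<omega>. trunc_moment (norm (Z \<omega>)) \<partial>M)"
proof -
  have [measurable]: "Z \<in> borel_measurable M" using Z by auto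
  show int: "integrable M (\<lambda>\<omega>. trunc_moment (norm (Z \<omega>)))"
    by (rule Bochner_Integration.integrable_bound[where f = "\<lambda>\<omega>. 4 * norm (Z \<omega>)"])
      (use Z in \<open>auto simp: trunc_moment_nonneg trunc_moment_le\<close>)
  have "prob {\<omega>\<in>space M. 1 < norm (Z \<omega>)} \<le> prob {\<omega>\<in>space M. 1 \<le> trunc_moment (norm (Z \<omega>))}"
    by (intro finite_measure_mono) (auto simp: trunc_moment_def)
  also have "\<dots> \<le> (\<integral>\<omega>. trunc_moment (norm (Z \<omega>)) \<partial>M) / 1"
    using int by (intro integral_Markov_inequality_measure[where A = "{}"]) (auto simp: trunc_moment_nonneg)
  finally show "prob {\<omega>\<in>space M. 1 < norm (Z \<omega>)} \<le> (\<integral>\<omega>. trunc_moment (norm (Z \<omega>)) \<partial>M)" by simp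
qed

text \<open>The variables are truncated at 1: the truncated parts are controlled in \<open>L\<^sup>2\<close>, the
  compensators of the remainders in \<open>L\<^sup>1\<close>.\<close>

lemma centered_sum_maximal_finite:
  fixes Z C :: "nat \<Rightarrow> 'a \<Rightarrow> 'h :: {real_inner, banach, second_countable_topology}"
  assumes sub: "\<And>k. subalgebra M (G k)" and mono: "\<And>k l. k \<le> l \<Longrightarrow> sets (G k) \<subseteq> sets (G l)"
    and meas: "\<And>k. Z k \<in> borel_measurable (G (Suc k))"
    and C: "\<And>k. is_cond_exp M (G k) (Z k) (C k)"
  shows "prob {\<omega>\<in>space M. \<exists>m\<le>n. 2 < norm (\<Sum>k<m. Z k \<omega> - C k \<omega>)}
    \<le> (\<Sum>k<n. \<integral>\<omega>. trunc_moment (norm (Z k \<omega>)) \<partial>M)"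
proof -
  define U where "U k \<omega> = (if norm (Z k \<omega>) \<le> 1 then Z k \<omega> else 0)" for k \<omega>
  define V where "V k \<omega> = Z k \<omega> - U k \<omega>" for k \<omega>
  define CU where "CU k = cond_exp M (G k) (U k)" for k
  \<comment> \<open>Defined by subtraction, so that \<open>Z\<close> - \<open>C\<close> =
    \<open>d\<close> + \<open>V\<close> - \<open>CV\<close> holds at every point; a version chosen
    independently for \<open>V\<close> would give this only almost everywhere.\<close>
  define CV where "CV k \<omega> = C k \<omega> - CU k \<omega>" for k \<omega>
  define d where "d k \<omega> = U k \<omega> - CU k \<omega>" for k \<omega>
  have intZ: "integrable M (Z k)" for k using C by (auto simp: is_cond_exp_def)
  have Z[measurable]: "Z k \<in> borel_measurable M" for k using intZ by auto
  have UG: "U k \<in> borel_measurable (G (Suc k))" for k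
    unfolding U_def using meas[of k] by measurable
  have U[measurable]: "U k \<in> borel_measurable M" for k by (rule measurable_from_subalg[OF sub UG])
  have intU: "integrable M (U k)" for k
    by (rule Bochner_Integration.integrable_bound[OF intZ[of k]]) (auto simp: U_def)
  have intV: "integrable M (V k)" for k
    unfolding V_def using intZ intU by auto
  have cU: "is_cond_exp M (G k) (U k) (CU k)" for k
    unfolding CU_def by (rule is_cond_exp_cond_exp[OF sub intU])
  have cV: "is_cond_exp M (G k) (V k) (CV k)" for k
    unfolding V_def CV_def by (rule is_cond_exp_diff[OF sub C cU])
  have intCU: "integrable M (CU k)" and CUG: "CU k \<in> borel_measurable (G k)" for k
    using cU[of k] by (auto simp: is_cond_exp_def)
  have intCV: "integrable M (CV k)" for k
    using cV[of k] by (auto simp: is_cond_exp_def)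
  have [measurable]: "CU k \<in> borel_measurable M" "CV k \<in> borel_measurable M" for k
    using intCU intCV by auto
  have cd: "is_cond_exp M (G k) (d k) (\<lambda>_. 0)" for k
    using is_cond_exp_diff[OF sub cU is_cond_exp_self[OF intCU CUG], of k] by (simp add: d_def[abs_def])
  have dG: "d k \<in> borel_measurable (G (Suc k))" for k
  proof -
    have "CU k \<in> borel_measurable (G (Suc k))"
      using CUG mono[of k "Suc k"] sub
      by (auto intro!: measurable_from_subalg[of "G (Suc k)" "G k"] simp: subalgebra_def)
    with UG show ?thesis unfolding d_def by (intro borel_measurable_diff)
  qed
  have sq_powr: "norm x powr 2 = (norm x)\<^sup>2" for x :: 'h by simp
  have U2: "integrable M (\<lambda>\<omega>. (norm (U k \<omega>))\<^sup>2)" for k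
    by (rule Bochner_Integration.integrable_bound[of M "\<lambda>_. 1 :: real"]) (auto simp: U_def power_le_one)
  have CU2: "integrable M (\<lambda>\<omega>. (norm (CU k \<omega>))\<^sup>2)"
    and CU2_le: "(\<integral>\<omega>. (norm (CU k \<omega>))\<^sup>2 \<partial>M) \<le> (\<integral>\<omega>. (norm (U k \<omega>))\<^sup>2 \<partial>M)" for k
    using is_cond_exp_Lp[OF sub cU, of 2 k] U2[of k] by (simp_all add: sq_powr)
  have d_le: "(norm (d k \<omega>))\<^sup>2 \<le> 2 * (norm (U k \<omega>))\<^sup>2 + 2 * (norm (CU k \<omega>))\<^sup>2" for k \<omega>
  proof -
    have "(norm (d k \<omega>))\<^sup>2 \<le> (norm (U k \<omega>) + norm (CU k \<omega>))\<^sup>2"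
      unfolding d_def by (intro power_mono norm_triangle_ineq4) simp
    also have "\<dots> \<le> 2 * (norm (U k \<omega>))\<^sup>2 + 2 * (norm (CU k \<omega>))\<^sup>2"
      using sum_squares_bound[of "norm (U k \<omega>)" "norm (CU k \<omega>)"] by (simp add: power2_sum)
    finally show ?thesis .
  qed
  have int2: "integrable M (\<lambda>\<omega>. 2 * (norm (U k \<omega>))\<^sup>2 + 2 * (norm (CU k \<omega>))\<^sup>2)" for k
    using U2 CU2 by simp
  have d2: "integrable M (\<lambda>\<omega>. (norm (d k \<omega>))\<^sup>2)" for k
    by (rule Bochner_Integration.integrable_bound[OF int2[of k]])
      (use d_le in \<open>auto simp: d_def[abs_def]\<close>)
  have d2_le: "(\<integral>\<omega>. (norm (d k \<omega>))\<^sup>2 \<partial>M) \<le> 4 * (\<integral>\<omega>. (norm (U k \<omega>))\<^sup>2 \<partial>M)" for k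
  proof -
    have "(\<integral>\<omega>. (norm (d k \<omega>))\<^sup>2 \<partial>M) \<le> (\<integral>\<omega>. 2 * (norm (U k \<omega>))\<^sup>2 + 2 * (norm (CU k \<omega>))\<^sup>2 \<partial>M)"
      by (intro integral_mono d2 int2 d_le)
    also have "\<dots> \<le> 4 * (\<integral>\<omega>. (norm (U k \<omega>))\<^sup>2 \<partial>M)"
      using U2 CU2 CU2_le[of k] by simp
    finally show ?thesis .
  qed
  let ?E1 = "\<lambda>k. {\<omega>\<in>space M. 1 < norm (Z k \<omega>)}"
  let ?E2 = "{\<omega>\<in>space M. 1 \<le> (\<Sum>k<n. norm (CV k \<omega>))}"
  let ?E3 = "{\<omega>\<in>space M. \<exists>m\<le>n. 1 < norm (\<Sum>k<m. d k \<omega>)}"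
  have [measurable]: "d k \<in> borel_measurable M" for k by (rule measurable_from_subalg[OF sub dG])
  have E3m: "?E3 \<in> sets M" by measurable
  \<comment> \<open>If no \<open>Z k\<close> with k < n exceeds 1 in norm, then every
    \<open>V k\<close> vanishes. The threshold 2 is then split into 1 for the martingale part and 1
    for the total norm of the compensators.\<close>
  have incl: "{\<omega>\<in>space M. \<exists>m\<le>n. 2 < norm (\<Sum>k<m. Z k \<omega> - C k \<omega>)} \<subseteq> (\<Union>k<n. ?E1 k) \<union> ?E2 \<union> ?E3"
  proof (intro subsetI, rule ccontr)
    fix \<omega>
    assume "\<omega> \<in> {\<omega>\<in>space M. \<exists>m\<le>n. 2 < norm (\<Sum>k<m. Z k \<omega> - C k \<omega>)}"
      and not: "\<omega> \<notin> (\<Union>k<n. ?E1 k) \<union> ?E2 \<union> ?E3"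
    then obtain m where \<omega>: "\<omega> \<in> space M" and m: "m \<le> n" "2 < norm (\<Sum>k<m. Z k \<omega> - C k \<omega>)"
      by blast
    have nE1: "norm (Z k \<omega>) \<le> 1" if "k < n" for k
      using not \<omega> that by (auto simp: not_less)
    have nE2: "(\<Sum>k<n. norm (CV k \<omega>)) < 1"
      using not \<omega> by simp
    have nE3: "norm (\<Sum>k<m. d k \<omega>) \<le> 1"
      using not \<omega> m(1) by (auto simp: not_less)
    have "(\<Sum>k<m. Z k \<omega> - C k \<omega>) = (\<Sum>k<m. d k \<omega> - CV k \<omega>)"
      using nE1 m by (intro sum.cong) (auto simp: d_def CV_def U_def)
    also have "\<dots> = (\<Sum>k<m. d k \<omega>) - (\<Sum>k<m. CV k \<omega>)" by (rule sum_subtractf)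
    finally have "2 < norm (\<Sum>k<m. d k \<omega>) + norm (\<Sum>k<m. CV k \<omega>)"
      using m(2) norm_triangle_ineq4[of "\<Sum>k<m. d k \<omega>" "\<Sum>k<m. CV k \<omega>"] by simp
    moreover have "norm (\<Sum>k<m. CV k \<omega>) \<le> (\<Sum>k<m. norm (CV k \<omega>))" by (rule norm_sum)
    moreover have "\<dots> \<le> (\<Sum>k<n. norm (CV k \<omega>))" using m(1) by (intro sum_mono2) auto
    ultimately show False using nE2 nE3 by linarith
  qed
  have "prob {\<omega>\<in>space M. \<exists>m\<le>n. 2 < norm (\<Sum>k<m. Z k \<omega> - C k \<omega>)} \<le> prob ((\<Union>k<n. ?E1 k) \<union> ?E2 \<union> ?E3)"
    using E3m by (intro finite_measure_mono incl) auto
  also have "\<dots> \<le> prob (\<Union>k<n. ?E1 k) + prob ?E2 + prob ?E3"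
    using E3m by (intro order_trans[OF measure_Un_le] add_mono) auto
  also have "\<dots> \<le> (\<Sum>k<n. prob (?E1 k)) + (\<Sum>k<n. \<integral>\<omega>. norm (V k \<omega>) \<partial>M)
      + (\<Sum>k<n. 4 * (\<integral>\<omega>. (norm (U k \<omega>))\<^sup>2 \<partial>M))"
  proof (intro add_mono)
    show "prob (\<Union>k<n. ?E1 k) \<le> (\<Sum>k<n. prob (?E1 k))"
      by (intro measure_UNION_le) auto
    have "prob ?E2 \<le> (\<integral>\<omega>. (\<Sum>k<n. norm (CV k \<omega>)) \<partial>M) / 1"
      using intCV by (intro integral_Markov_inequality_measure[where A = "{}"]) (auto intro!: AE_I2 sum_nonneg)
    also have "\<dots> = (\<Sum>k<n. \<integral>\<omega>. norm (CV k \<omega>) \<partial>M)"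
      using intCV by simp
    also have "\<dots> \<le> (\<Sum>k<n. \<integral>\<omega>. norm (V k \<omega>) \<partial>M)"
      by (intro sum_mono integral_norm_is_cond_exp_le[OF sub cV])
    finally show "prob ?E2 \<le> (\<Sum>k<n. \<integral>\<omega>. norm (V k \<omega>) \<partial>M)" .
    have "prob ?E3 \<le> (\<Sum>k<n. \<integral>\<omega>. (norm (d k \<omega>))\<^sup>2 \<partial>M)"
      by (rule martingale_maximal_finite[of G d, OF sub mono dG cd d2])
    also have "\<dots> \<le> (\<Sum>k<n. 4 * (\<integral>\<omega>. (norm (U k \<omega>))\<^sup>2 \<partial>M))"
      by (intro sum_mono d2_le)
    finally show "prob ?E3 \<le> (\<Sum>k<n. 4 * (\<integral>\<omega>. (norm (U k \<omega>))\<^sup>2 \<partial>M))" .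
  qed
  also have "\<dots> = (\<Sum>k<n. prob (?E1 k) + (\<integral>\<omega>. norm (V k \<omega>) \<partial>M) + 4 * (\<integral>\<omega>. (norm (U k \<omega>))\<^sup>2 \<partial>M))"
    by (simp add: sum.distrib)
  also have "\<dots> \<le> (\<Sum>k<n. \<integral>\<omega>. trunc_moment (norm (Z k \<omega>)) \<partial>M)"
  proof (rule sum_mono)
    fix k
    have E1m: "?E1 k \<in> sets M" by measurable
    have "prob (?E1 k) + (\<integral>\<omega>. norm (V k \<omega>) \<partial>M) + 4 * (\<integral>\<omega>. (norm (U k \<omega>))\<^sup>2 \<partial>M)
        = (\<integral>\<omega>. indicator (?E1 k) \<omega> + norm (V k \<omega>) + 4 * (norm (U k \<omega>))\<^sup>2 \<partial>M)"
      using E1m intV U2 by (simp add: emeasure_eq_measure)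
    also have "\<dots> \<le> (\<integral>\<omega>. trunc_moment (norm (Z k \<omega>)) \<partial>M)"
    proof (rule integral_mono)
      show "integrable M (\<lambda>\<omega>. indicator (?E1 k) \<omega> + norm (V k \<omega>) + 4 * (norm (U k \<omega>))\<^sup>2)"
        using E1m intV U2 by (simp add: emeasure_eq_measure)
      show "integrable M (\<lambda>\<omega>. trunc_moment (norm (Z k \<omega>)))" by (rule integrable_trunc_moment_norm[OF intZ])
      fix \<omega>
      show "indicator (?E1 k) \<omega> + norm (V k \<omega>) + 4 * (norm (U k \<omega>))\<^sup>2 \<le> trunc_moment (norm (Z k \<omega>))"
        by (auto simp: trunc_moment_def V_def U_def indicator_def)
    qed
    finally show "prob (?E1 k) + (\<integral>\<omega>. norm (V k \<omega>) \<partial>M) + 4 * (\<integral>\<omega>. (norm (U k \<omega>))\<^sup>2 \<partial>M)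
      \<le> (\<integral>\<omega>. trunc_moment (norm (Z k \<omega>)) \<partial>M)" .
  qed
  finally show ?thesis .
qed

end

section \<open>Maximal inequalities over all times and the strong law\<close>

lemma (in prob_space) prob_Ex_le:
  fixes P :: "nat \<Rightarrow> 'a \<Rightarrow> bool"
  assumes [measurable]: "\<And>m. {\<omega>\<in>space M. P m \<omega>} \<in> events"
    and le: "\<And>n. prob {\<omega>\<in>space M. \<exists>m\<le>n. P m \<omega>} \<le> b"
  shows "prob {\<omega>\<in>space M. \<exists>m. P m \<omega>} \<le> b"
proof -
  let ?A = "\<lambda>n. {\<omega>\<in>space M. \<exists>m\<le>n. P m \<omega>}"
  have "(\<lambda>n. prob (?A n)) \<longlonglongrightarrow> prob (\<Union>n. ?A n)"
  proof (rule finite_Lim_measure_incseq)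
    show "range ?A \<subseteq> events" by auto
    show "incseq ?A" by (auto simp: incseq_def intro: order_trans)
  qed
  then have "prob (\<Union>n. ?A n) \<le> b"
    by (rule LIMSEQ_le_const2) (use le in auto)
  also have "(\<Union>n. ?A n) = {\<omega>\<in>space M. \<exists>m. P m \<omega>}" by auto
  finally show ?thesis .
qed

lemma AE_tendsto_zeroI:
  fixes f :: "nat \<Rightarrow> 'a \<Rightarrow> real"
  assumes "\<And>e. 0 < e \<Longrightarrow> AE \<omega> in M. \<forall>\<^sub>F n in sequentially. \<bar>f n \<omega>\<bar> \<le> e"
  shows "AE \<omega> in M. (\<lambda>n. f n \<omega>) \<longlonglongrightarrow> 0"
proof -
  have "AE \<omega> in M. \<forall>i. \<forall>\<^sub>F n in sequentially. \<bar>f n \<omega>\<bar> \<le> 1 / real (Suc i)"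
    by (subst AE_all_countable) (intro allI assms, simp)
  then show ?thesis
  proof eventually_elim
    case (elim \<omega>)
    show ?case
    proof (rule tendstoI)
      fix e :: real assume "0 < e"
      then obtain i where "1 / real (Suc i) < e" using nat_approx_posE by blast
      with elim[rule_format, of i] show "\<forall>\<^sub>F n in sequentially. dist (f n \<omega>) 0 < e"
        by (auto elim!: eventually_mono)
    qed
  qed
qed

text \<open>Only the norms are required to be identically distributed, and no independence is
  assumed. The locale is used three times: for the increments of the given sequence, for the
  martingale at each dyadic level, and for the sequence of single blocks at a level.\<close>

locale ident_adapted = prob_space M for M :: "'a measure" +
  fixes p :: real and G :: "nat \<Rightarrow> 'a measure"
    and Z C :: "nat \<Rightarrow> 'a \<Rightarrow> 'h :: {real_inner, banach, second_countable_topology}"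
  assumes p: "1 < p" "p < 2"
    and sub: "\<And>k. subalgebra M (G k)" and mono: "\<And>k l. k \<le> l \<Longrightarrow> sets (G k) \<subseteq> sets (G l)"
    and meas: "\<And>k. Z k \<in> borel_measurable (G (Suc k))"
    and cond: "\<And>k. is_cond_exp M (G k) (Z k) (C k)"
    and ident: "\<And>k. distr M borel (\<lambda>\<omega>. norm (Z k \<omega>)) = distr M borel (\<lambda>\<omega>. norm (Z 0 \<omega>))"
    and Lp: "integrable M (\<lambda>\<omega>. norm (Z 0 \<omega>) powr p)"
begin

text \<open>Truncation cost at index k when the truncation level is \<tau> (k + 1)^(1/p). Its
  summability over k, with a sum of order \<tau>^(-p), is all that the p-th moment is used
  for.\<close>

definition rate :: "real \<Rightarrow> nat \<Rightarrow> real" where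
  "rate \<tau> k = (\<integral>\<omega>. trunc_moment (norm (Z 0 \<omega>) / \<tau> / real (Suc k) powr (1 / p)) \<partial>M)"

lemma integrable_Z: "integrable M (Z k)"
  using cond by (auto simp: is_cond_exp_def)

lemma measurable_Z [measurable]: "Z k \<in> borel_measurable M"
  using integrable_Z by auto

lemma measurable_C [measurable]: "C k \<in> borel_measurable M"
  by (rule borel_measurable_integrable) (use cond[of k] in \<open>simp add: is_cond_exp_def\<close>)

lemma integrable_trunc_moment:
  assumes "0 < s" "0 < t"
  shows "integrable M (\<lambda>\<omega>. trunc_moment (norm (Z k \<omega>) / s / t))"
proof -
  have "integrable M (\<lambda>\<omega>. (1 / (s * t)) *\<^sub>R Z k \<omega>)" using integrable_Z by simp
  from integrable_trunc_moment_norm[OF this] show ?thesis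
    using assms by (simp add: divide_divide_eq_left)
qed

lemma expectation_trunc_moment:
  assumes "0 < \<tau>"
  shows "(\<integral>\<omega>. trunc_moment (norm (Z k \<omega>) / \<tau> / real (Suc j) powr (1 / p)) \<partial>M) = rate \<tau> j"
proof -
  have "(\<integral>\<omega>. trunc_moment (norm (Z k \<omega>) / \<tau> / real (Suc j) powr (1 / p)) \<partial>M)
      = (\<integral>x. trunc_moment (x / \<tau> / real (Suc j) powr (1 / p)) \<partial>distr M borel (\<lambda>\<omega>. norm (Z k \<omega>)))"
    by (subst integral_distr) auto
  also have "\<dots> = (\<integral>x. trunc_moment (x / \<tau> / real (Suc j) powr (1 / p)) \<partial>distr M borel (\<lambda>\<omega>. norm (Z 0 \<omega>)))"
    by (simp only: ident[of k])
  also have "\<dots> = rate \<tau> j"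
    unfolding rate_def by (subst integral_distr) auto
  finally show ?thesis .
qed

lemma rate_nonneg: "0 < \<tau> \<Longrightarrow> 0 \<le> rate \<tau> k"
  unfolding rate_def by (intro Bochner_Integration.integral_nonneg trunc_moment_nonneg) auto

lemma sum_rate_le:
  assumes "0 < \<tau>"
  shows "(\<Sum>k<n. rate \<tau> k) \<le> trunc_const p * (\<integral>\<omega>. norm (Z 0 \<omega>) powr p \<partial>M) / \<tau> powr p"
proof -
  have int: "integrable M (\<lambda>\<omega>. trunc_moment (norm (Z 0 \<omega>) / \<tau> / real (Suc k) powr (1 / p)))" for k
    using assms by (intro integrable_trunc_moment) auto
  have "(\<Sum>k<n. rate \<tau> k) = (\<integral>\<omega>. (\<Sum>k<n. trunc_moment (norm (Z 0 \<omega>) / \<tau> / real (Suc k) powr (1 / p))) \<partial>M)"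
    unfolding rate_def using int by (intro Bochner_Integration.integral_sum[symmetric])
  also have "\<dots> \<le> (\<integral>\<omega>. trunc_const p * (norm (Z 0 \<omega>) / \<tau>) powr p \<partial>M)"
    using int Lp assms by (intro integral_mono sum_trunc_moment_le p Bochner_Integration.integrable_sum)
      (auto simp: powr_divide)
  also have "\<dots> = trunc_const p * (\<integral>\<omega>. norm (Z 0 \<omega>) powr p \<partial>M) / \<tau> powr p"
    using assms by (simp add: powr_divide)
  finally show ?thesis .
qed

lemma summable_rate: "0 < \<tau> \<Longrightarrow> summable (rate \<tau>)"
  using rate_nonneg sum_rate_le by (intro summableI_nonneg_bounded) auto

lemma suminf_rate_le:
  "0 < \<tau> \<Longrightarrow> suminf (rate \<tau>) \<le> trunc_const p * (\<integral>\<omega>. norm (Z 0 \<omega>) powr p \<partial>M) / \<tau> powr p"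
  by (intro suminf_le_const summable_rate sum_rate_le)

text \<open>The normalisation sits inside the sum, as Kronecker's lemma requires. Dropping the
  indices below \<open>K\<close> lets one estimate serve both as a maximal inequality, with
  \<open>K\<close> = 0, and as a Cauchy criterion, with \<open>K\<close> large.\<close>

definition W :: "nat \<Rightarrow> nat \<Rightarrow> 'a \<Rightarrow> 'h" where
  "W K k \<omega> = (if k < K then 0 else (1 / real (Suc k) powr (1 / p)) *\<^sub>R (Z k \<omega> - C k \<omega>))"

lemma measurable_W [measurable]: "W K k \<in> borel_measurable M"
  unfolding W_def[abs_def] by (cases "k < K") auto

text \<open>The finite maximal inequality bounds the probability by the rates between
  \<open>K\<close> and n, hence for every n by the tail of a convergent series, which tends to 0 as
  \<open>K\<close> grows.\<close>

lemma prob_sum_W_le: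
  assumes \<tau>: "0 < \<tau>"
  shows "prob {\<omega>\<in>space M. \<exists>m. 2 * \<tau> < norm (\<Sum>k<m. W K k \<omega>)} \<le> suminf (rate \<tau>) - (\<Sum>k<K. rate \<tau> k)"
proof (rule prob_Ex_le)
  fix n
  \<comment> \<open>With this scaling, truncation at 1 is truncation of \<open>Z k\<close> at \<tau>
    (k + 1)^(1/p).\<close>
  define a where "a k = (if k < K then 0 else 1 / (\<tau> * real (Suc k) powr (1 / p)))" for k
  have a_nonneg: "0 \<le> a k" for k using \<tau> by (simp add: a_def)
  have W_eq: "a k *\<^sub>R Z k \<omega> - a k *\<^sub>R C k \<omega> = (1 / \<tau>) *\<^sub>R W K k \<omega>" for k \<omega>
    by (simp add: a_def W_def scaleR_diff_right)
  have "(2 * \<tau> < norm (\<Sum>k<m. W K k \<omega>)) = (2 < norm (\<Sum>k<m. a k *\<^sub>R Z k \<omega> - a k *\<^sub>R C k \<omega>))" for m \<omega>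
  proof -
    have "norm (\<Sum>k<m. a k *\<^sub>R Z k \<omega> - a k *\<^sub>R C k \<omega>) = norm (\<Sum>k<m. W K k \<omega>) / \<tau>"
      unfolding W_eq using \<tau> by (simp flip: scaleR_sum_right)
    then show ?thesis using \<tau> by (simp add: pos_less_divide_eq)
  qed
  then have "prob {\<omega>\<in>space M. \<exists>m\<le>n. 2 * \<tau> < norm (\<Sum>k<m. W K k \<omega>)}
      = prob {\<omega>\<in>space M. \<exists>m\<le>n. 2 < norm (\<Sum>k<m. a k *\<^sub>R Z k \<omega> - a k *\<^sub>R C k \<omega>)}"
    by simp
  also have "\<dots> \<le> (\<Sum>k<n. \<integral>\<omega>. trunc_moment (norm (a k *\<^sub>R Z k \<omega>)) \<partial>M)"
  proof (rule centered_sum_maximal_finite[of G "\<lambda>k \<omega>. a k *\<^sub>R Z k \<omega>" "\<lambda>k \<omega>. a k *\<^sub>R C k \<omega>", OF sub mono])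
    show "(\<lambda>\<omega>. a k *\<^sub>R Z k \<omega>) \<in> borel_measurable (G (Suc k))" for k
      using meas by (intro borel_measurable_scaleR) auto
    show "is_cond_exp M (G k) (\<lambda>\<omega>. a k *\<^sub>R Z k \<omega>) (\<lambda>\<omega>. a k *\<^sub>R C k \<omega>)" for k
      by (rule is_cond_exp_bounded_linear[OF sub bounded_linear_scaleR_right cond])
  qed
  also have "\<dots> = (\<Sum>k<n. if k < K then 0 else rate \<tau> k)"
  proof (intro sum.cong refl)
    fix k
    have *: "norm (a k *\<^sub>R Z k \<omega>) = norm (Z k \<omega>) / \<tau> / real (Suc k) powr (1 / p)" if "\<not> k < K" for \<omega>
      using that \<tau> by (simp add: a_def divide_divide_eq_left)
    show "(\<integral>\<omega>. trunc_moment (norm (a k *\<^sub>R Z k \<omega>)) \<partial>M) = (if k < K then 0 else rate \<tau> k)"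
    proof (cases "k < K")
      case False
      with * show ?thesis by (simp only: expectation_trunc_moment[OF \<tau>] if_False simp_thms)
    qed (simp add: a_def)
  qed
  also have "\<dots> = (\<Sum>k\<in>{K..<n}. rate \<tau> k)"
    by (rule sum.mono_neutral_cong_right) auto
  also have "\<dots> \<le> suminf (rate \<tau>) - (\<Sum>k<K. rate \<tau> k)"
  proof -
    have "(\<Sum>k<K. rate \<tau> k) + (\<Sum>k\<in>{K..<n}. rate \<tau> k) = (\<Sum>k\<in>{..<K} \<union> {K..<n}. rate \<tau> k)"
      by (rule sum.union_disjoint[symmetric]) auto
    also have "\<dots> \<le> suminf (rate \<tau>)"
      by (intro sum_le_suminf summable_rate \<tau> rate_nonneg ballI) auto
    finally show ?thesis by simp
  qed
  finally show "prob {\<omega>\<in>space M. \<exists>m\<le>n. 2 * \<tau> < norm (\<Sum>k<m. W K k \<omega>)} \<le> suminf (rate \<tau>) - (\<Sum>k<K. rate \<tau> k)" .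
qed measurable

lemma norm_tail_sum_le:
  assumes "\<And>m. norm (\<Sum>k<m. W K k \<omega>) \<le> \<delta>"
  shows "norm (\<Sum>k<m. if k < K then 0 else Z k \<omega> - C k \<omega>) \<le> 2 * \<delta> * real (Suc m) powr (1 / p)"
proof -
  have "norm (\<Sum>k<m. real (Suc k) powr (1 / p) *\<^sub>R W K k \<omega>) \<le> 2 * \<delta> * real (Suc m) powr (1 / p)"
    by (rule abel_norm_sum_le) (use p assms in \<open>auto intro!: incseq_SucI powr_mono2\<close>)
  also have "(\<Sum>k<m. real (Suc k) powr (1 / p) *\<^sub>R W K k \<omega>) = (\<Sum>k<m. if k < K then 0 else Z k \<omega> - C k \<omega>)"
    by (intro sum.cong) (auto simp: W_def)
  finally show ?thesis .
qed

text \<open>The weak-type inequality, uniform in m, that controls a whole level by a single event.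
  In the factor 4, one 2 is the threshold of the truncation argument and the other comes from
  summation by parts.\<close>

lemma prob_centered_sum_le:
  assumes \<tau>: "0 < \<tau>"
  shows "prob {\<omega>\<in>space M. \<exists>m. 4 * \<tau> * real (Suc m) powr (1 / p) < norm (\<Sum>k<m. Z k \<omega> - C k \<omega>)}
    \<le> trunc_const p * (\<integral>\<omega>. norm (Z 0 \<omega>) powr p \<partial>M) / \<tau> powr p"
proof -
  have "prob {\<omega>\<in>space M. \<exists>m. 4 * \<tau> * real (Suc m) powr (1 / p) < norm (\<Sum>k<m. Z k \<omega> - C k \<omega>)}
      \<le> prob {\<omega>\<in>space M. \<exists>m. 2 * \<tau> < norm (\<Sum>k<m. W 0 k \<omega>)}"
  proof (rule finite_measure_mono)
    show "{\<omega>\<in>space M. \<exists>m. 4 * \<tau> * real (Suc m) powr (1 / p) < norm (\<Sum>k<m. Z k \<omega> - C k \<omega>)}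
        \<subseteq> {\<omega>\<in>space M. \<exists>m. 2 * \<tau> < norm (\<Sum>k<m. W 0 k \<omega>)}"
    proof safe
      fix \<omega> m
      assume less: "4 * \<tau> * real (Suc m) powr (1 / p) < norm (\<Sum>k<m. Z k \<omega> - C k \<omega>)"
      show "\<exists>m. 2 * \<tau> < norm (\<Sum>k<m. W 0 k \<omega>)"
      proof (rule ccontr)
        assume "\<not> ?thesis"
        then have "norm (\<Sum>k<m. W 0 k \<omega>) \<le> 2 * \<tau>" for m by (auto simp: not_less)
        from norm_tail_sum_le[OF this, of m] less show False by simp
      qed
    qed
  qed measurable
  also have "\<dots> \<le> suminf (rate \<tau>)"
    using prob_sum_W_le[OF \<tau>, of 0] by simp
  also have "\<dots> \<le> trunc_const p * (\<integral>\<omega>. norm (Z 0 \<omega>) powr p \<partial>M) / \<tau> powr p"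
    by (rule suminf_rate_le[OF \<tau>])
  finally show ?thesis .
qed

lemma Suc_powr_at_top: "filterlim (\<lambda>m. real (Suc m) powr (1 / p)) at_top sequentially"
  unfolding filterlim_at_top
proof
  fix B :: real
  show "\<forall>\<^sub>F m in sequentially. B \<le> real (Suc m) powr (1 / p)"
    using eventually_ge_at_top[of "nat \<lceil>max B 1 powr p\<rceil>"]
  proof eventually_elim
    case (elim m)
    have "p * (1 / p) = 1" using p by simp
    then have "(max B 1 powr p) powr (1 / p) = max B 1 powr 1"
      by (simp only: powr_powr)
    also have "\<dots> = max B 1" by (rule powr_one) simp
    finally have "(max B 1 powr p) powr (1 / p) = max B 1" .
    moreover have "max B 1 powr p \<le> real (Suc m)" using elim by linarith
    then have "(max B 1 powr p) powr (1 / p) \<le> real (Suc m) powr (1 / p)"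
      using p by (intro powr_mono2) auto
    ultimately show ?case by simp
  qed
qed

text \<open>That the weighted sums started at \<open>K\<close> exceed 2 \<tau> for every
  \<open>K\<close> has probability below every tail of a convergent series, hence 0. For a good
  \<open>K\<close>, summation by parts bounds the part after \<open>K\<close>, and the finitely many
  earlier terms are swallowed by the growing normalisation.\<close>

lemma AE_centered_sum_tendsto_0:
  "AE \<omega> in M. (\<lambda>m. norm (\<Sum>k<m. Z k \<omega> - C k \<omega>) / real (Suc m) powr (1 / p)) \<longlonglongrightarrow> 0"
proof (rule AE_tendsto_zeroI)
  fix e :: real assume e: "0 < e"
  \<comment> \<open>4 \<tau> bounds the part after \<open>K\<close>, and one more \<tau> absorbs the
    initial sum.\<close>
  define \<tau> where "\<tau> = e / 5"
  have \<tau>: "0 < \<tau>" using e by (simp add: \<tau>_def)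
  let ?N = "{\<omega>\<in>space M. \<forall>K. \<exists>m. 2 * \<tau> < norm (\<Sum>k<m. W K k \<omega>)}"
  have "prob ?N \<le> suminf (rate \<tau>) - (\<Sum>k<K. rate \<tau> k)" for K
    by (rule order_trans[OF finite_measure_mono prob_sum_W_le[OF \<tau>]]) (auto, measurable)
  moreover have "(\<lambda>K. suminf (rate \<tau>) - (\<Sum>k<K. rate \<tau> k)) \<longlonglongrightarrow> suminf (rate \<tau>) - suminf (rate \<tau>)"
    by (intro tendsto_diff tendsto_const summable_LIMSEQ summable_rate \<tau>)
  ultimately have "prob ?N \<le> 0"
    by (intro LIMSEQ_le_const[where X = "\<lambda>K. suminf (rate \<tau>) - (\<Sum>k<K. rate \<tau> k)"]) auto
  then have "prob ?N = 0" using measure_nonneg[of M ?N] by linarith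
  then have "AE \<omega> in M. \<not> (\<forall>K. \<exists>m. 2 * \<tau> < norm (\<Sum>k<m. W K k \<omega>))"
    by (subst (asm) prob_Collect_eq_0) measurable
  then show "AE \<omega> in M. \<forall>\<^sub>F m in sequentially. \<bar>norm (\<Sum>k<m. Z k \<omega> - C k \<omega>) / real (Suc m) powr (1 / p)\<bar> \<le> e"
  proof eventually_elim
    case (elim \<omega>)
    then obtain K where "norm (\<Sum>k<m. W K k \<omega>) \<le> 2 * \<tau>" for m
      by (auto simp: not_less)
    from norm_tail_sum_le[OF this]
    have tail: "norm (\<Sum>k<m. if k < K then 0 else Z k \<omega> - C k \<omega>) \<le> 4 * \<tau> * real (Suc m) powr (1 / p)" for m
      by simp
    let ?A = "norm (\<Sum>k<K. Z k \<omega> - C k \<omega>)"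
    have "\<forall>\<^sub>F m in sequentially. ?A / \<tau> \<le> real (Suc m) powr (1 / p)"
      using Suc_powr_at_top unfolding filterlim_at_top by blast
    with eventually_ge_at_top[of K] show ?case
    proof eventually_elim
      case (elim m)
      have "(\<Sum>k<m. Z k \<omega> - C k \<omega>) = (\<Sum>k<m. if k < K then Z k \<omega> - C k \<omega> else 0)
          + (\<Sum>k<m. if k < K then 0 else Z k \<omega> - C k \<omega>)"
        unfolding sum.distrib[symmetric] by (intro sum.cong) auto
      also have "(\<Sum>k<m. if k < K then Z k \<omega> - C k \<omega> else 0) = (\<Sum>k<K. Z k \<omega> - C k \<omega>)"
        using elim(1) by (intro sum.mono_neutral_cong_right) auto
      finally have "norm (\<Sum>k<m. Z k \<omega> - C k \<omega>) \<le> ?A + 4 * \<tau> * real (Suc m) powr (1 / p)"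
        using norm_triangle_ineq[of "\<Sum>k<K. Z k \<omega> - C k \<omega>" "\<Sum>k<m. if k < K then 0 else Z k \<omega> - C k \<omega>"]
          tail[of m] by simp
      moreover have "?A \<le> \<tau> * real (Suc m) powr (1 / p)"
        using elim(2) \<tau> by (simp add: pos_divide_le_eq mult.commute)
      ultimately have "norm (\<Sum>k<m. Z k \<omega> - C k \<omega>) \<le> e * real (Suc m) powr (1 / p)"
        by (simp add: \<tau>_def)
      then show ?case by (simp add: pos_divide_le_eq)
    qed
  qed
qed

lemma prob_norm_Z_le:
  assumes \<tau>: "0 < \<tau>"
  shows "prob {\<omega>\<in>space M. \<tau> * real (Suc k) powr (1 / p) < norm (Z k \<omega>)} \<le> rate \<tau> k"
proof -
  have int: "integrable M (\<lambda>\<omega>. (1 / (\<tau> * real (Suc k) powr (1 / p))) *\<^sub>R Z k \<omega>)"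
    using integrable_Z by simp
  have eq: "norm ((1 / (\<tau> * real (Suc k) powr (1 / p))) *\<^sub>R Z k \<omega>) = norm (Z k \<omega>) / \<tau> / real (Suc k) powr (1 / p)" for \<omega>
    using \<tau> by simp
  have "(1 < norm (Z k \<omega>) / \<tau> / real (Suc k) powr (1 / p)) = (\<tau> * real (Suc k) powr (1 / p) < norm (Z k \<omega>))" for \<omega>
    using \<tau> by (simp add: pos_less_divide_eq mult.commute)
  with prob_norm_gt_1_le[OF int] show ?thesis
    unfolding eq expectation_trunc_moment[OF \<tau>] by simp
qed

text \<open>A union bound suffices here, since single variables are compared with the normalisation.
  This controls the unpaired block that an odd number of blocks leaves over at a level.\<close>

lemma prob_Ex_norm_Z_le:
  assumes \<tau>: "0 < \<tau>"
  shows "prob {\<omega>\<in>space M. \<exists>k. \<tau> * real (Suc k) powr (1 / p) < norm (Z k \<omega>)}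
    \<le> trunc_const p * (\<integral>\<omega>. norm (Z 0 \<omega>) powr p \<partial>M) / \<tau> powr p"
proof (rule prob_Ex_le)
  fix n
  have "{\<omega>\<in>space M. \<exists>k\<le>n. \<tau> * real (Suc k) powr (1 / p) < norm (Z k \<omega>)}
      = (\<Union>k\<in>{..n}. {\<omega>\<in>space M. \<tau> * real (Suc k) powr (1 / p) < norm (Z k \<omega>)})" by auto
  then have "prob {\<omega>\<in>space M. \<exists>k\<le>n. \<tau> * real (Suc k) powr (1 / p) < norm (Z k \<omega>)}
      \<le> (\<Sum>k\<in>{..n}. prob {\<omega>\<in>space M. \<tau> * real (Suc k) powr (1 / p) < norm (Z k \<omega>)})"
    by (simp only:) (intro measure_UNION_le, auto)
  also have "\<dots> \<le> (\<Sum>k\<in>{..n}. rate \<tau> k)"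
    by (intro sum_mono prob_norm_Z_le \<tau>)
  also have "\<dots> \<le> trunc_const p * (\<integral>\<omega>. norm (Z 0 \<omega>) powr p \<partial>M) / \<tau> powr p"
    using sum_rate_le[OF \<tau>, of "Suc n"] by (simp only: lessThan_Suc_atMost)
  finally show "prob {\<omega>\<in>space M. \<exists>k\<le>n. \<tau> * real (Suc k) powr (1 / p) < norm (Z k \<omega>)}
    \<le> trunc_const p * (\<integral>\<omega>. norm (Z 0 \<omega>) powr p \<partial>M) / \<tau> powr p" .
qed measurable

lemma AE_norm_Z_tendsto_0:
  "AE \<omega> in M. (\<lambda>k. norm (Z k \<omega>) / real (Suc k) powr (1 / p)) \<longlonglongrightarrow> 0"
proof (rule AE_tendsto_zeroI)
  fix \<tau> :: real assume \<tau>: "0 < \<tau>"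
  let ?A = "\<lambda>k. {\<omega>\<in>space M. \<tau> * real (Suc k) powr (1 / p) < norm (Z k \<omega>)}"
  have "AE \<omega> in M. \<forall>\<^sub>F k in sequentially. \<omega> \<in> space M - ?A k"
  proof (rule borel_cantelli_AE1)
    show "summable (\<lambda>k. prob (?A k))"
      by (rule summable_comparison_test'[OF summable_rate[OF \<tau>], where N = 0])
        (use prob_norm_Z_le[OF \<tau>] in auto)
  qed (auto simp: emeasure_eq_measure)
  then show "AE \<omega> in M. \<forall>\<^sub>F k in sequentially. \<bar>norm (Z k \<omega>) / real (Suc k) powr (1 / p)\<bar> \<le> \<tau>"
  proof eventually_elim
    case (elim \<omega>)
    then show ?case
      by eventually_elim (auto simp: pos_divide_le_eq not_less)
  qed
qed

end

section \<open>Dyadic decomposition of sums\<close>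

text \<open>For 2 \<le> k \<le> n the value \<open>V k\<close> is its summand times at most n^(3/2)
  / ln 2, so these values add up to at most s n^(3/2) / ln 2. Since \<open>V n\<close> is bounded by
  \<open>V k\<close> + \<open>V (n - k)\<close> up to a constant for each of about n values of k,
  dividing by their number leaves n^(1/2).\<close>

lemma sqrt_growth_if_quasi_subadditive:
  fixes V :: "nat \<Rightarrow> real"
  assumes V: "\<And>n. 0 \<le> V n" and quasi: "\<And>n m. V (n + m) \<le> K * (V n + V m)"
    and sum: "(\<lambda>n. ln (real n) * (V n / real n powr (3 / 2))) summable_on {2..}"
  obtains C where "0 \<le> C" "\<And>n. 1 \<le> n \<Longrightarrow> V n \<le> C * real n powr (1 / 2)"
proof -
  let ?f = "\<lambda>n. ln (real n) * (V n / real n powr (3 / 2))"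
  define s where "s = infsum ?f {2..}"
  have f_nonneg: "0 \<le> ?f n" for n using V[of n] by (cases "n = 0") auto
  have s: "0 \<le> s" unfolding s_def by (intro infsum_nonneg f_nonneg)
  have ln2: "0 < ln (2::real)" by simp
  define K' where "K' = max K 0"
  have quasi': "V (n + m) \<le> K' * (V n + V m)" for n m
  proof -
    have "K * (V n + V m) \<le> K' * (V n + V m)"
      using V[of n] V[of m] by (intro mult_right_mono) (auto simp: K'_def)
    with quasi[of n m] show ?thesis by linarith
  qed
  have K': "0 \<le> K'" by (simp add: K'_def)
  \<comment> \<open>The finite sum settles n < 6. From 6 on, the number n - 3 of admissible k is at
    least n / 2; this gives one factor 2 of the 4, and the symmetry between k and n - k gives the
    other.\<close>
  define C where "C = 4 * K' * s / ln 2 + (\<Sum>k<6. V k)"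
  have C1: "0 \<le> 4 * K' * s / ln 2" using K' s ln2 by simp
  have C2: "0 \<le> (\<Sum>k<6. V k)" using V by (intro sum_nonneg)
  have "V n \<le> C * real n powr (1 / 2)" if n: "1 \<le> n" for n
  proof (cases "n < 6")
    case True
    have "V n \<le> (\<Sum>k<6. V k)" using True V by (intro member_le_sum) auto
    also have "\<dots> \<le> C" using C1 by (simp add: C_def)
    also have "C \<le> C * real n powr (1 / 2)"
      using mult_left_mono[of 1 "real n powr (1 / 2)" C] C1 C2 n by (simp add: C_def ge_one_powr_ge_zero)
    finally show ?thesis .
  next
    case False
    have Vk: "V k \<le> ?f k * (real n powr (3 / 2) / ln 2)" if "2 \<le> k" "k \<le> n" for k
    proof -
      have "V k = ?f k * (real k powr (3 / 2) / ln (real k))" using that by simp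
      also have "\<dots> \<le> ?f k * (real n powr (3 / 2) / ln 2)"
        using that by (intro mult_left_mono f_nonneg frac_le powr_mono2) auto
      finally show ?thesis .
    qed
    have "real (n - 3) * V n = (\<Sum>k\<in>{2..n-2}. V n)" using False by simp
    also have "\<dots> \<le> (\<Sum>k\<in>{2..n-2}. K' * (V k + V (n - k)))"
    proof (rule sum_mono)
      fix k assume "k \<in> {2..n-2}"
      then show "V n \<le> K' * (V k + V (n - k))" using quasi'[of k "n - k"] False by auto
    qed
    also have "\<dots> = K' * ((\<Sum>k\<in>{2..n-2}. V k) + (\<Sum>k\<in>{2..n-2}. V (n - k)))"
      by (simp add: sum_distrib_left[symmetric] sum.distrib)
    also have "(\<Sum>k\<in>{2..n-2}. V (n - k)) = (\<Sum>k\<in>{2..n-2}. V k)"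
      by (rule sum.reindex_bij_witness[of _ "\<lambda>k. n - k" "\<lambda>k. n - k"]) (use False in auto)
    also have "(\<Sum>k\<in>{2..n-2}. V k) \<le> (\<Sum>k\<in>{2..n-2}. ?f k * (real n powr (3 / 2) / ln 2))"
      by (intro sum_mono Vk) auto
    also have "\<dots> = (\<Sum>k\<in>{2..n-2}. ?f k) * (real n powr (3 / 2) / ln 2)"
      by (rule sum_distrib_right[symmetric])
    also have "\<dots> \<le> s * (real n powr (3 / 2) / ln 2)"
      unfolding s_def by (intro mult_right_mono finite_sum_le_infsum sum f_nonneg) auto
    finally have *: "real (n - 3) * V n \<le> K' * (2 * (s * (real n powr (3 / 2) / ln 2)))"
      using K' by (simp add: mult_left_mono)
    have "real n / 2 * V n \<le> real (n - 3) * V n"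
      using False V by (intro mult_right_mono) auto
    also note *
    also have "real n powr (3 / 2) = real n * real n powr (1 / 2)"
      using n powr_add[of "real n" 1 "1 / 2"] by simp
    finally have "real n * V n \<le> real n * (4 * K' * s / ln 2 * real n powr (1 / 2))"
      by (simp add: field_simps)
    then have "V n \<le> 4 * K' * s / ln 2 * real n powr (1 / 2)"
      by (rule mult_left_le_imp_le) (use n in simp)
    also have "\<dots> \<le> C * real n powr (1 / 2)"
      using C2 by (intro mult_right_mono) (auto simp: C_def)
    finally show ?thesis .
  qed
  moreover have "0 \<le> C" using C1 C2 by (simp add: C_def)
  ultimately show ?thesis by (intro that)
qed

text \<open>If \<open>z j k\<close> is the conditional expectation of the \<open>k\<close>-th block of length \<open>2 ^ j\<close> given the past of
  that block, then \<open>z (j + 1) k - z j (2 k)\<close> is the conditional expectation of \<open>z j (2 k + 1)\<close> given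
  the past of block \<open>2 k\<close>. Hence \<open>level_sum z j\<close> is a martingale.\<close>

definition level_sum :: "(nat \<Rightarrow> nat \<Rightarrow> 'b :: ab_group_add) \<Rightarrow> nat \<Rightarrow> nat \<Rightarrow> 'b" where
  "level_sum z j m = (\<Sum>k<m. z j (2 * k + 1) - (z (Suc j) k - z j (2 * k)))"

text \<open>Blocks 2 k and 2 k + 1 are merged into block k of the next level, and the error of
  merging is the k-th increment of \<open>level_sum\<close>. For odd n the last block has no
  partner.\<close>

lemma sum_level_step:
  "(\<Sum>k<n. z j k) = (\<Sum>k<n div 2. z (Suc j) k) + level_sum z j (n div 2)
     + (if odd n then z j (n - 1) else 0)"
proof -
  have even: "(\<Sum>k<2 * m. z j k) = (\<Sum>k<m. z (Suc j) k) + level_sum z j m" for m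
    by (induction m) (simp_all add: level_sum_def algebra_simps)
  show ?thesis
  proof (cases "odd n")
    case True
    then obtain m where "n = Suc (2 * m)" by (auto elim: oddE)
    then show ?thesis using even[of m] by simp
  next
    case False
    then show ?thesis using even[of "n div 2"] by simp
  qed
qed

lemma sum_level_decomposition:
  "(\<Sum>k<n. z 0 k) = (\<Sum>k<n div 2 ^ J. z J k) + (\<Sum>j<J. level_sum z j (n div 2 ^ Suc j)
     + (if odd (n div 2 ^ j) then z j (n div 2 ^ j - 1) else 0))"
proof (induction J)
  case (Suc J)
  have "n div 2 ^ J div 2 = n div 2 ^ Suc J" by (simp only: power_Suc2 div_mult2_eq)
  with Suc show ?case
    using sum_level_step[where z = z and j = J and n = "n div 2 ^ J"]
    by (simp add: algebra_simps del: power_Suc)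
qed simp

text \<open>The value 0 for n < 2^j makes the series over j finite. It also excludes the case in
  which \<open>n div 2 ^ j - 1\<close> would truncate to 0 and charge the first block to a level
  that has none. The single block is charged for either parity.\<close>

definition level_term :: "(nat \<Rightarrow> nat \<Rightarrow> 'b :: real_normed_vector) \<Rightarrow> nat \<Rightarrow> nat \<Rightarrow> real" where
  "level_term z j n = (if n < 2 ^ j then 0 else
     norm (level_sum z j (n div 2 ^ Suc j)) + norm (z j (n div 2 ^ j - 1)))"

lemma norm_sum_le_level_terms:
  "norm (\<Sum>k<n. z 0 k) \<le> (\<Sum>j. level_term z j n)"
proof -
  have lt: "n < 2 ^ j" if "n \<le> j" for j
    using that less_exp[of j] by linarith
  have le: "norm (level_sum z j (n div 2 ^ Suc j) + (if odd (n div 2 ^ j) then z j (n div 2 ^ j - 1) else 0))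
      \<le> level_term z j n" for j
  proof (cases "n < 2 ^ j")
    case True
    then have "n div 2 ^ j = 0" "n div 2 ^ Suc j = 0" by simp_all
    then show ?thesis by (simp add: level_term_def level_sum_def)
  next
    case False
    then show ?thesis
      by (auto simp: level_term_def norm_triangle_ineq simp del: power_Suc)
  qed
  \<comment> \<open>Going up n levels leaves no block at the top, because n < 2^n.\<close>
  have "(\<Sum>k<n. z 0 k) = (\<Sum>j<n. level_sum z j (n div 2 ^ Suc j)
     + (if odd (n div 2 ^ j) then z j (n div 2 ^ j - 1) else 0))"
    unfolding sum_level_decomposition[of z n n] using lt[of n] by simp
  also have "norm \<dots> \<le> (\<Sum>j<n. level_term z j n)"
    by (intro sum_norm_le le)
  also have "\<dots> = (\<Sum>j. level_term z j n)"
    by (rule suminf_finite[symmetric]) (auto simp: level_term_def lt)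
  finally show ?thesis .
qed

lemma filterlim_div_at_top:
  assumes "0 < (d :: nat)"
  shows "filterlim (\<lambda>n. n div d) sequentially sequentially"
  unfolding filterlim_at_top
proof
  fix N
  show "\<forall>\<^sub>F n in sequentially. N \<le> n div d"
    using eventually_ge_at_top[of "N * d"]
    by eventually_elim (use assms in \<open>auto simp: less_eq_div_iff_mult_less_eq\<close>)
qed

text \<open>A deterministic statement, applied path by path. Level j has at most about n / 2^j
  terms, so the factor 2^(j/p) of the bounds cancels and n^(1/p) \<rho>^j remains: a majorant
  independent of n, as Tannery's theorem requires. The bounds are asked only for large j, since
  Borel-Cantelli provides no more.\<close>

lemma level_sums_tendsto_0:
  fixes z :: "nat \<Rightarrow> nat \<Rightarrow> 'b :: real_normed_vector" and p :: real
  assumes p: "1 < p" and \<rho>: "0 \<le> \<rho>" "\<rho> < 1" and K: "0 \<le> K"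
    and lim1: "\<And>j. (\<lambda>m. norm (level_sum z j m) / real (Suc m) powr (1 / p)) \<longlonglongrightarrow> 0"
    and lim2: "\<And>j. (\<lambda>m. norm (z j m) / real (Suc m) powr (1 / p)) \<longlonglongrightarrow> 0"
    and bound1: "\<forall>\<^sub>F j in sequentially. \<forall>m. norm (level_sum z j m)
      \<le> K * (2 ^ j) powr (1 / p) * \<rho> ^ j * real (Suc m) powr (1 / p)"
    and bound2: "\<forall>\<^sub>F j in sequentially. \<forall>m. norm (z j m)
      \<le> K * (2 ^ j) powr (1 / p) * \<rho> ^ j * real (Suc m) powr (1 / p)"
  shows "(\<lambda>n. norm (\<Sum>k<n. z 0 k) / real n powr (1 / p)) \<longlonglongrightarrow> 0"
proof -
  define a where "a j n = level_term z j n / real n powr (1 / p)" for j n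
  have a_nonneg: "0 \<le> a j n" for j n by (simp add: a_def level_term_def)
  have two: "2 powr (1 / p) \<le> (2::real)"
    using p powr_mono[of "1 / p" 1 "2::real"] by simp
  \<comment> \<open>Since n / 2^j \<ge> 1, the successor is absorbed by doubling, and 2^(1/p) \<le>
    2.\<close>
  have sub1: "real (Suc (n div 2 ^ Suc j)) powr (1 / p) \<le> 2 * (real n powr (1 / p) / (2 ^ j) powr (1 / p))"
    and sub2: "real (Suc (n div 2 ^ j - 1)) powr (1 / p) \<le> 2 * (real n powr (1 / p) / (2 ^ j) powr (1 / p))"
    if n: "2 ^ j \<le> n" for n j
  proof -
    have j: "real (n div 2 ^ j) \<le> real n / 2 ^ j"
      using of_nat_div_le_of_nat[of n "2 ^ j", where ?'a = real] by simp
    have j': "real (n div 2 ^ Suc j) \<le> real n / 2 ^ j / 2"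
      using of_nat_div_le_of_nat[of n "2 ^ Suc j", where ?'a = real] by (simp add: field_simps)
    have "real (2 ^ j) \<le> real n" using n by (simp only: of_nat_le_iff)
    then have ge1: "1 \<le> real n / 2 ^ j" by (simp add: pos_le_divide_eq)
    have pos: "1 \<le> n div 2 ^ j" using n by (simp add: less_eq_div_iff_mult_less_eq)
    have "x powr (1 / p) \<le> 2 * (real n powr (1 / p) / (2 ^ j) powr (1 / p))"
      if "0 \<le> x" "x \<le> 2 * (real n / 2 ^ j)" for x
    proof -
      have "x powr (1 / p) \<le> (2 * (real n / 2 ^ j)) powr (1 / p)"
        using that p by (intro powr_mono2) auto
      also have "\<dots> = 2 powr (1 / p) * (real n powr (1 / p) / (2 ^ j) powr (1 / p))"
        by (simp add: powr_mult powr_divide)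
      also have "\<dots> \<le> 2 * (real n powr (1 / p) / (2 ^ j) powr (1 / p))"
        using two by (intro mult_right_mono) auto
      finally show ?thesis .
    qed
    from this[of "real (Suc (n div 2 ^ Suc j))"] this[of "real (Suc (n div 2 ^ j - 1))"]
    show "real (Suc (n div 2 ^ Suc j)) powr (1 / p) \<le> 2 * (real n powr (1 / p) / (2 ^ j) powr (1 / p))"
      "real (Suc (n div 2 ^ j - 1)) powr (1 / p) \<le> 2 * (real n powr (1 / p) / (2 ^ j) powr (1 / p))"
      using j j' ge1 pos by (auto simp del: power_Suc)
  qed
  have "((\<lambda>n. a j n) \<longlongrightarrow> 0) sequentially" for j
  proof (rule Lim_null_comparison)
    let ?b = "\<lambda>n. 2 * (norm (level_sum z j (n div 2 ^ Suc j)) / real (Suc (n div 2 ^ Suc j)) powr (1 / p)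
      + norm (z j (n div 2 ^ j - 1)) / real (Suc (n div 2 ^ j - 1)) powr (1 / p))"
    have d1: "filterlim (\<lambda>n. n div 2 ^ Suc j) sequentially sequentially"
      by (rule filterlim_div_at_top) simp
    have d2: "filterlim (\<lambda>n. n div 2 ^ j - 1) sequentially sequentially"
      by (rule filterlim_compose[OF filterlim_minus_const_nat_at_top filterlim_div_at_top]) simp
    have "?b \<longlonglongrightarrow> 2 * (0 + 0)"
      by (intro tendsto_mult tendsto_const tendsto_add filterlim_compose[OF lim1 d1] filterlim_compose[OF lim2 d2])
    then show "?b \<longlonglongrightarrow> 0" by simp
    show "\<forall>\<^sub>F n in sequentially. norm (a j n) \<le> ?b n"
      using eventually_ge_at_top[of "2 ^ j"]
    proof eventually_elim
      case (elim n)
      have n0: "0 < real n powr (1 / p)" using elim by (auto intro: ccontr)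
      have le: "x / real n powr (1 / p) \<le> 2 * (x / y)"
        if "0 \<le> x" "0 < y" "y \<le> 2 * (real n powr (1 / p) / (2 ^ j) powr (1 / p))" for x y
      proof -
        have "real n powr (1 / p) / (2 ^ j) powr (1 / p) \<le> real n powr (1 / p) / 1"
          using p by (intro divide_left_mono) (auto simp: ge_one_powr_ge_zero)
        with that have "y \<le> 2 * real n powr (1 / p)" by simp
        then have "y * x \<le> 2 * real n powr (1 / p) * x" using that by (intro mult_right_mono)
        then show ?thesis using that n0 by (simp add: field_simps)
      qed
      have "norm (a j n) = norm (level_sum z j (n div 2 ^ Suc j)) / real n powr (1 / p)
          + norm (z j (n div 2 ^ j - 1)) / real n powr (1 / p)"
        using elim a_nonneg[of j n] by (simp add: a_def level_term_def add_divide_distrib)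
      also have "\<dots> \<le> ?b n"
        unfolding distrib_left using sub1[OF elim] sub2[OF elim] by (intro add_mono le) auto
      finally show ?case .
    qed
  qed
  \<comment> \<open>In the constant 4, each of the two norms in \<open>level_term\<close>
    contributes 2, the factor lost in \<open>sub1\<close> and \<open>sub2\<close>.\<close>
  moreover have "\<forall>\<^sub>F (j, n) in sequentially \<times>\<^sub>F sequentially. norm (a j n) \<le> 4 * K * \<rho> ^ j"
  proof -
    have "\<forall>\<^sub>F j in sequentially. \<forall>n. norm (a j n) \<le> 4 * K * \<rho> ^ j"
      using bound1 bound2
    proof eventually_elim
      case (elim j)
      show ?case
      proof
        fix n
        show "norm (a j n) \<le> 4 * K * \<rho> ^ j"
        proof (cases "n < 2 ^ j")
          case True
          then show ?thesis using K \<rho> by (simp add: a_def level_term_def)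
        next
          case False
          then have n: "2 ^ j \<le> n" by simp
          let ?t = "(2 ^ j) powr (1 / p) :: real"
          have t: "0 < ?t" by simp
          have n0: "0 < real n powr (1 / p)" using n by (auto intro: ccontr)
          have le: "x \<le> 2 * K * \<rho> ^ j * real n powr (1 / p)"
            if "x \<le> K * ?t * \<rho> ^ j * y" "y \<le> 2 * (real n powr (1 / p) / ?t)" for x y
          proof -
            have "K * ?t * \<rho> ^ j * y \<le> K * ?t * \<rho> ^ j * (2 * (real n powr (1 / p) / ?t))"
              using K \<rho> that(2) by (intro mult_left_mono) auto
            also have "\<dots> = 2 * K * \<rho> ^ j * real n powr (1 / p)" using t by simp
            finally show ?thesis using that(1) by simp
          qed
          have "level_term z j n \<le> 2 * K * \<rho> ^ j * real n powr (1 / p) + 2 * K * \<rho> ^ j * real n powr (1 / p)"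
            unfolding level_term_def if_not_P[OF False]
            by (intro add_mono le[OF elim(1)[rule_format] sub1[OF n]] le[OF elim(2)[rule_format] sub2[OF n]])
          then have "a j n \<le> 4 * K * \<rho> ^ j"
            using n0 by (simp add: a_def pos_divide_le_eq)
          then show ?thesis using a_nonneg[of j n] by simp
        qed
      qed
    qed
    then show ?thesis
      unfolding eventually_prod_filter
      by (intro exI[of _ "\<lambda>j. \<forall>n. norm (a j n) \<le> 4 * K * \<rho> ^ j"] exI[of _ "\<lambda>_. True"]) auto
  qed
  moreover have "summable (\<lambda>j. 4 * K * \<rho> ^ j)"
    using \<rho> by (intro summable_mult summable_geometric) auto
  ultimately have "(\<lambda>n. \<Sum>j. a j n) \<longlonglongrightarrow> (\<Sum>j. 0)"
    using tannerys_theorem[where a = a and b = "\<lambda>_. 0" and M = "\<lambda>j. 4 * K * \<rho> ^ j" and F = sequentially] by simp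
  then have lim: "(\<lambda>n. \<Sum>j. a j n) \<longlonglongrightarrow> 0" by simp
  show ?thesis
  proof (rule Lim_null_comparison[OF always_eventually lim], rule allI)
    fix n
    have "(\<Sum>j. a j n) = (\<Sum>j. level_term z j n) / real n powr (1 / p)"
      unfolding a_def
    proof (rule suminf_divide)
      have "n < 2 ^ j" if "n \<le> j" for j
        using that less_exp[of j] by linarith
      then show "summable (\<lambda>j. level_term z j n)"
        by (intro summable_finite[of "{..<n}"]) (auto simp: level_term_def)
    qed
    then show "norm (norm (\<Sum>k<n. z 0 k) / real n powr (1 / p)) \<le> (\<Sum>j. a j n)"
      using norm_sum_le_level_terms[of z n] by (simp add: divide_right_mono)
  qed
qed

section \<open>Stationary processes\<close>

lemma norm_add_powr_le:
  fixes a b :: "'b :: real_normed_vector" and p :: real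
  assumes p: "0 \<le> p"
  shows "norm (a + b) powr p \<le> 2 powr p * (norm a powr p + norm b powr p)"
proof -
  have "norm (a + b) powr p \<le> (2 * max (norm a) (norm b)) powr p"
    using p norm_triangle_ineq[of a b] by (intro powr_mono2) auto
  also have "\<dots> = 2 powr p * max (norm a) (norm b) powr p"
    by (simp add: powr_mult)
  also have "\<dots> \<le> 2 powr p * (norm a powr p + norm b powr p)"
    by (intro mult_left_mono) (auto simp: max_def)
  finally show ?thesis .
qed

lemma integrable_add_powr:
  fixes f g :: "'a \<Rightarrow> 'b :: {banach, second_countable_topology}" and p :: real
  assumes p: "0 \<le> p" and [measurable]: "f \<in> borel_measurable M" "g \<in> borel_measurable M"
    and int: "integrable M (\<lambda>\<omega>. norm (f \<omega>) powr p)" "integrable M (\<lambda>\<omega>. norm (g \<omega>) powr p)"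
  shows "integrable M (\<lambda>\<omega>. norm (f \<omega> + g \<omega>) powr p)"
  by (rule Bochner_Integration.integrable_bound[where f = "\<lambda>\<omega>. 2 powr p * (norm (f \<omega>) powr p + norm (g \<omega>) powr p)"])
    (use int norm_add_powr_le[OF p] in auto)

lemma (in prob_space) integrable_of_powr:
  fixes f :: "'a \<Rightarrow> 'b :: {banach, second_countable_topology}" and p :: real
  assumes p: "1 \<le> p" and [measurable]: "f \<in> borel_measurable M" and int: "integrable M (\<lambda>\<omega>. norm (f \<omega>) powr p)"
  shows "integrable M f"
proof (rule Bochner_Integration.integrable_bound)
  show "integrable M (\<lambda>\<omega>. 1 + norm (f \<omega>) powr p)" using int by simp
  show "AE \<omega> in M. norm (f \<omega>) \<le> norm (1 + norm (f \<omega>) powr p)"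
  proof (intro AE_I2)
    fix \<omega>
    show "norm (f \<omega>) \<le> norm (1 + norm (f \<omega>) powr p)"
    proof (cases "norm (f \<omega>) \<le> 1")
      case False
      then have "norm (f \<omega>) powr 1 \<le> norm (f \<omega>) powr p" using p by (intro powr_mono) auto
      with False show ?thesis by simp
    qed (simp add: add_increasing2)
  qed
qed simp

context stationary_setting
begin

lemma space_F0: "space F0 = space M"
  using subalg by (simp add: subalgebra_def)

lemma measurable_funpow: "\<theta> ^^ n \<in> M \<rightarrow>\<^sub>M M"
  by (rule measurable_compose_n[OF measurable_theta])

lemma distr_funpow: "distr M M (\<theta> ^^ n) = M"
proof (induction n)
  case 0
  show ?case by (simp add: distr_id2 id_def)
next
  case (Suc n)
  have "distr M M (\<theta> ^^ Suc n) = distr (distr M M (\<theta> ^^ n)) M \<theta>"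
    by (simp add: distr_distr[OF measurable_theta measurable_funpow])
  also have "\<dots> = M" by (simp only: Suc preserving)
  finally show ?case .
qed

lemma iterate_int: "iterate M \<theta> (int n) = \<theta> ^^ n"
  by (simp add: iterate_def)

lemma measurable_iterate: "iterate M \<theta> i \<in> M \<rightarrow>\<^sub>M M"
  unfolding iterate_def by (auto intro: measurable_compose_n measurable_theta measurable_inverse)

lemma space_filt: "space (filt M \<theta> F0 i) = space M"
  by (simp add: filt_def)

lemma sets_filt: "sets (filt M \<theta> F0 i) = {iterate M \<theta> i -` B \<inter> space M | B. B \<in> sets F0}"
  unfolding filt_def using measurable_space[OF measurable_iterate]
  by (intro sets_vimage_algebra2) (auto simp: space_F0)

lemma subalgebra_filt: "subalgebra M (filt M \<theta> F0 i)"
proof -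
  have "iterate M \<theta> i -` B \<inter> space M \<in> sets M" if "B \<in> sets F0" for B
    using measurable_sets[OF measurable_iterate] that subalg by (auto simp: subalgebra_def)
  then show ?thesis by (auto simp: subalgebra_def space_filt sets_filt)
qed

lemma sets_filt_0: "sets (filt M \<theta> F0 0) = sets F0"
proof -
  have "B \<inter> space M = B" if "B \<in> sets F0" for B
    using sets.sets_into_space[OF that] by (auto simp: space_F0)
  then have "(\<lambda>B. B \<inter> space M) ` sets F0 = sets F0" by simp
  then show ?thesis by (simp add: sets_filt iterate_def setcompr_eq_image)
qed

lemma filt_mono:
  assumes "m \<le> n"
  shows "sets (filt M \<theta> F0 (int m)) \<subseteq> sets (filt M \<theta> F0 (int n))"
  using assms
proof (induction rule: dec_induct)
  case (step n)
  have "sets (filt M \<theta> F0 (int n)) \<subseteq> sets (filt M \<theta> F0 (int (Suc n)))"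
  proof
    fix A assume "A \<in> sets (filt M \<theta> F0 (int n))"
    then obtain B where B: "B \<in> sets F0" "A = (\<theta> ^^ n) -` B \<inter> space M"
      by (auto simp: sets_filt iterate_int)
    have "B \<in> sets (vimage_algebra (space M) \<theta> F0)"
      by (rule subsetD[OF F0_subset B(1)])
    also have "sets (vimage_algebra (space M) \<theta> F0) = {\<theta> -` B \<inter> space M | B. B \<in> sets F0}"
      using measurable_space[OF measurable_theta] by (intro sets_vimage_algebra2) (auto simp: space_F0)
    finally obtain B' where B': "B' \<in> sets F0" "B = \<theta> -` B' \<inter> space M" by blast
    have "A = (\<theta> ^^ Suc n) -` B' \<inter> space M"
      using B(2) B'(2) measurable_space[OF measurable_funpow] by auto
    with B'(1) show "A \<in> sets (filt M \<theta> F0 (int (Suc n)))"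
      unfolding sets_filt iterate_int by blast
  qed
  with step show ?case by blast
qed simp

lemma measurable_shift:
  assumes "Y \<in> borel_measurable F0"
  shows "(\<lambda>\<omega>. Y ((\<theta> ^^ n) \<omega>)) \<in> borel_measurable (filt M \<theta> F0 (int n))"
proof -
  have "\<theta> ^^ n \<in> filt M \<theta> F0 (int n) \<rightarrow>\<^sub>M F0"
    unfolding filt_def iterate_int using measurable_space[OF measurable_funpow]
    by (intro measurable_vimage_algebra1) (auto simp: space_F0)
  from measurable_compose[OF this assms] show ?thesis by simp
qed

lemma integrable_shift:
  fixes f :: "'a \<Rightarrow> 'b :: {banach, second_countable_topology}"
  assumes "integrable M f"
  shows "integrable M (\<lambda>\<omega>. f ((\<theta> ^^ n) \<omega>))"
  using assms integrable_distr[OF measurable_funpow, of n f] by (simp only: distr_funpow)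

lemma integral_shift:
  fixes f :: "'a \<Rightarrow> 'b :: {banach, second_countable_topology}"
  assumes "f \<in> borel_measurable M"
  shows "(\<integral>\<omega>. f ((\<theta> ^^ n) \<omega>) \<partial>M) = (\<integral>\<omega>. f \<omega> \<partial>M)"
  using integral_distr[OF measurable_funpow assms, of n] by (simp only: distr_funpow)

lemma distr_shift:
  fixes f :: "'a \<Rightarrow> real"
  assumes "f \<in> borel_measurable M"
  shows "distr M borel (\<lambda>\<omega>. f ((\<theta> ^^ n) \<omega>)) = distr M borel f"
  using distr_distr[OF assms measurable_funpow[of n]] by (simp only: distr_funpow comp_def)

text \<open>A set of the shifted \<sigma>-algebra is the preimage of some \<open>B\<close> in
  \<open>F0\<close>, so by invariance of the measure both integrals over it are integrals over
  \<open>B\<close>.\<close>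

lemma is_cond_exp_shift:
  fixes X :: "'a \<Rightarrow> 'h :: {real_inner, banach, second_countable_topology}"
  assumes XY: "is_cond_exp M F0 X Y"
  shows "is_cond_exp M (filt M \<theta> F0 (int n)) (\<lambda>\<omega>. X ((\<theta> ^^ n) \<omega>)) (\<lambda>\<omega>. Y ((\<theta> ^^ n) \<omega>))"
  unfolding is_cond_exp_def
proof (intro conjI ballI)
  from XY have int: "integrable M X" "integrable M Y" and Y: "Y \<in> borel_measurable F0"
    by (auto simp: is_cond_exp_def)
  from int show "integrable M (\<lambda>\<omega>. X ((\<theta> ^^ n) \<omega>))" "integrable M (\<lambda>\<omega>. Y ((\<theta> ^^ n) \<omega>))"
    by (auto intro: integrable_shift)
  from Y show "(\<lambda>\<omega>. Y ((\<theta> ^^ n) \<omega>)) \<in> borel_measurable (filt M \<theta> F0 (int n))"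
    by (rule measurable_shift)
  fix A assume "A \<in> sets (filt M \<theta> F0 (int n))"
  then obtain B where B: "B \<in> sets F0" "A = (\<theta> ^^ n) -` B \<inter> space M"
    by (auto simp: sets_filt iterate_int)
  have BM: "B \<in> sets M" using B(1) subalg by (auto simp: subalgebra_def)
  have eq: "set_lebesgue_integral M A (\<lambda>\<omega>. f ((\<theta> ^^ n) \<omega>)) = set_lebesgue_integral M B f"
    if "integrable M f" for f :: "'a \<Rightarrow> 'h"
  proof -
    have "set_lebesgue_integral M A (\<lambda>\<omega>. f ((\<theta> ^^ n) \<omega>))
        = (\<integral>\<omega>. indicator B ((\<theta> ^^ n) \<omega>) *\<^sub>R f ((\<theta> ^^ n) \<omega>) \<partial>M)"
      unfolding set_lebesgue_integral_def B(2)
      by (intro Bochner_Integration.integral_cong) (auto simp: indicator_def)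
    also have "\<dots> = set_lebesgue_integral M B f"
      unfolding set_lebesgue_integral_def using BM that by (intro integral_shift) auto
    finally show ?thesis .
  qed
  show "set_lebesgue_integral M A (\<lambda>\<omega>. Y ((\<theta> ^^ n) \<omega>)) = set_lebesgue_integral M A (\<lambda>\<omega>. X ((\<theta> ^^ n) \<omega>))"
    using XY B(1) int by (simp add: eq is_cond_exp_def)
qed

text \<open>\<open>cond_exp\<close> picks an arbitrary version, so for the zero variable it vanishes
  only almost everywhere; this follows from the \<open>L^1\<close> contraction.\<close>

lemma zero_stationary_mart_diff:
  "stationary_mart_diff M \<theta> F0 p (\<lambda>_ _. 0 :: 'h :: {real_inner, banach, second_countable_topology})"
proof -
  have "AE \<omega> in M. cond_exp M (filt M \<theta> F0 (k - 1)) (\<lambda>_. 0 :: 'h) \<omega> = 0" for k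
  proof -
    let ?Y = "cond_exp M (filt M \<theta> F0 (k - 1)) (\<lambda>_. 0 :: 'h)"
    have ce: "is_cond_exp M (filt M \<theta> F0 (k - 1)) (\<lambda>_. 0) ?Y"
      by (rule is_cond_exp_cond_exp[OF subalgebra_filt]) simp
    have "(\<integral>\<omega>. norm (?Y \<omega>) \<partial>M) = 0"
      using integral_norm_is_cond_exp_le[OF subalgebra_filt ce]
      by (intro antisym) (auto intro: Bochner_Integration.integral_nonneg)
    then have "AE \<omega> in M. norm (?Y \<omega>) = 0"
      using ce by (subst (asm) integral_nonneg_eq_0_iff_AE) (auto simp: is_cond_exp_def)
    then show ?thesis by simp
  qed
  then show ?thesis
    by (simp add: stationary_mart_diff_def adapted_stationary_seq_def in_Lp_def)
qed

end

section \<open>Conditional expectations of the partial sums and of the dyadic blocks\<close>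

locale adapted_process = stationary_setting M \<theta> F0
  for M :: "'a measure" and \<theta> F0 +
  fixes p :: real and x :: "'a \<Rightarrow> 'h :: {real_inner, banach, second_countable_topology}"
  assumes p: "1 < p" "p < 2"
    and x_F0: "x \<in> borel_measurable F0" and x_Lp: "integrable M (\<lambda>\<omega>. norm (x \<omega>) powr p)"
begin

definition S :: "nat \<Rightarrow> 'a \<Rightarrow> 'h" where
  "S n \<omega> = (\<Sum>k<n. x ((\<theta> ^^ Suc k) \<omega>))"

text \<open>\<open>Y n\<close> is the paper's \<open>E\<^sub>0(S\<^sub>n)\<close>. By stationarity, \<open>z \<omega> j k\<close> is the conditional expectation of the
  block of length \<open>2 ^ j\<close> that starts after time \<open>k 2 ^ j\<close>, given the past of that time.\<close>

definition Y :: "nat \<Rightarrow> 'a \<Rightarrow> 'h" where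
  "Y n = cond_exp M (filt M \<theta> F0 0) (S n)"

definition z :: "'a \<Rightarrow> nat \<Rightarrow> nat \<Rightarrow> 'h" where
  "z \<omega> j k = Y (2 ^ j) ((\<theta> ^^ (k * 2 ^ j)) \<omega>)"

lemma S_add: "S (n + m) \<omega> = S n \<omega> + S m ((\<theta> ^^ n) \<omega>)"
proof -
  have "(\<theta> ^^ Suc (n + k)) \<omega> = (\<theta> ^^ Suc k) ((\<theta> ^^ n) \<omega>)" for k
    using fun_cong[OF funpow_add[of "Suc k" n \<theta>], of \<omega>] by (simp add: add.commute del: funpow.simps)
  then show ?thesis
    by (induction m) (simp_all add: S_def add.assoc del: funpow.simps)
qed

lemma x_meas [measurable]: "x \<in> borel_measurable M"
  by (rule measurable_from_subalg[OF subalg x_F0])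

lemma S_Lp: "S n \<in> borel_measurable M \<and> integrable M (\<lambda>\<omega>. norm (S n \<omega>) powr p)"
proof (induction n)
  case (Suc n)
  let ?x = "\<lambda>\<omega>. x ((\<theta> ^^ Suc n) \<omega>)"
  have S: "S n \<in> borel_measurable M" "integrable M (\<lambda>\<omega>. norm (S n \<omega>) powr p)"
    using Suc by auto
  have x: "?x \<in> borel_measurable M" "integrable M (\<lambda>\<omega>. norm (?x \<omega>) powr p)"
    by (rule measurable_compose[OF measurable_funpow x_meas], rule integrable_shift[OF x_Lp])
  have "S (Suc n) = (\<lambda>\<omega>. S n \<omega> + ?x \<omega>)"
    by (simp add: S_def fun_eq_iff del: funpow.simps)
  moreover have "integrable M (\<lambda>\<omega>. norm (S n \<omega> + ?x \<omega>) powr p)"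
    by (rule integrable_add_powr[OF _ S(1) x(1) S(2) x(2)]) (use p in simp)
  ultimately show ?case
    by (simp only: borel_measurable_add[OF S(1) x(1)] simp_thms)
qed (simp add: S_def[abs_def])

lemma integrable_S: "integrable M (S n)"
  using S_Lp p by (auto intro: integrable_of_powr[where p = p and f = "S n"])

lemma cond_exp_Y: "is_cond_exp M F0 (S n) (Y n)"
proof -
  have "is_cond_exp M (filt M \<theta> F0 0) (S n) (Y n)"
    unfolding Y_def by (rule is_cond_exp_cond_exp[OF subalgebra_filt integrable_S])
  then show ?thesis
    by (subst is_cond_exp_cong_sets[of _ "filt M \<theta> F0 0"]) (auto simp: space_F0 space_filt sets_filt_0)
qed

lemma Y_F0: "Y n \<in> borel_measurable F0"
  using cond_exp_Y by (simp add: is_cond_exp_def)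

lemma Y_meas [measurable]: "Y n \<in> borel_measurable M"
  by (rule measurable_from_subalg[OF subalg Y_F0])

lemma Y_Lp: "integrable M (\<lambda>\<omega>. norm (Y n \<omega>) powr p)"
  using is_cond_exp_Lp(1)[OF subalg cond_exp_Y] p S_Lp by auto

text \<open>The shifted \<open>Y m\<close> is the conditional expectation at time n of the sum from
  n + 1 to n + m, that is of \<open>S (n + m)\<close> - \<open>S n\<close>, and the tower property
  brings it down to time 0. Both the quasi-subadditivity of the norms and the martingale property at
  each level rest on this identity.\<close>

lemma cond_exp_Y_shift: "is_cond_exp M F0 (\<lambda>\<omega>. Y m ((\<theta> ^^ n) \<omega>)) (\<lambda>\<omega>. Y (n + m) \<omega> - Y n \<omega>)"
proof (rule is_cond_exp_tower)
  show "is_cond_exp M F0 (\<lambda>\<omega>. S m ((\<theta> ^^ n) \<omega>)) (\<lambda>\<omega>. Y (n + m) \<omega> - Y n \<omega>)"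
    using is_cond_exp_diff[OF subalg cond_exp_Y[of "n + m"] cond_exp_Y[of n]] by (simp add: S_add)
  show "is_cond_exp M (filt M \<theta> F0 (int n)) (\<lambda>\<omega>. S m ((\<theta> ^^ n) \<omega>)) (\<lambda>\<omega>. Y m ((\<theta> ^^ n) \<omega>))"
    by (rule is_cond_exp_shift[OF cond_exp_Y])
  show "sets F0 \<subseteq> sets (filt M \<theta> F0 (int n))"
    using filt_mono[of 0 n] by (simp add: sets_filt_0)
qed

text \<open>\<open>Y (n + m)\<close> is \<open>Y n\<close> plus a conditional expectation of the
  shifted \<open>Y m\<close>, which does not increase the norm. In place of Minkowski's inequality a
  crude bound for powers of sums is used; it costs 2 2^(1/p) \<le> 4.\<close>

lemma Lp_norm_Y_add_le: "Lp_norm M p (Y (n + m)) \<le> 4 * (Lp_norm M p (Y n) + Lp_norm M p (Y m))"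
proof -
  let ?v = "\<lambda>n. \<integral>\<omega>. norm (Y n \<omega>) powr p \<partial>M"
  have v: "0 \<le> ?v n" for n by simp
  have shift_Lp: "integrable M (\<lambda>\<omega>. norm (Y m ((\<theta> ^^ n) \<omega>)) powr p)"
    by (rule integrable_shift[OF Y_Lp])
  have d: "integrable M (\<lambda>\<omega>. norm (Y (n + m) \<omega> - Y n \<omega>) powr p)"
    "(\<integral>\<omega>. norm (Y (n + m) \<omega> - Y n \<omega>) powr p \<partial>M) \<le> (\<integral>\<omega>. norm (Y m ((\<theta> ^^ n) \<omega>)) powr p \<partial>M)"
    using is_cond_exp_Lp[OF subalg cond_exp_Y_shift _ shift_Lp] p by auto
  have "?v (n + m) \<le> (\<integral>\<omega>. 2 powr p * (norm (Y n \<omega>) powr p + norm (Y (n + m) \<omega> - Y n \<omega>) powr p) \<partial>M)"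
  proof (intro integral_mono)
    show "norm (Y (n + m) \<omega>) powr p
        \<le> 2 powr p * (norm (Y n \<omega>) powr p + norm (Y (n + m) \<omega> - Y n \<omega>) powr p)" for \<omega>
      using p norm_add_powr_le[of p "Y n \<omega>" "Y (n + m) \<omega> - Y n \<omega>"] by simp
  qed (use Y_Lp d(1) in auto)
  also have "\<dots> = 2 powr p * (?v n + (\<integral>\<omega>. norm (Y (n + m) \<omega> - Y n \<omega>) powr p \<partial>M))"
    using Y_Lp d(1) by simp
  also have "\<dots> \<le> 2 powr p * (?v n + ?v m)"
    using d(2) integral_shift[of "\<lambda>\<omega>. norm (Y m \<omega>) powr p" n] by (intro mult_left_mono add_mono) auto
  also have "\<dots> \<le> 2 powr p * (2 * max (?v n) (?v m))"
    by (intro mult_left_mono) auto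
  finally have "?v (n + m) powr (1 / p) \<le> (2 powr p * (2 * max (?v n) (?v m))) powr (1 / p)"
    using p v by (intro powr_mono2) auto
  also have "\<dots> = (2 powr p) powr (1 / p) * (2 powr (1 / p) * max (?v n) (?v m) powr (1 / p))"
    using v by (simp only: powr_mult) 
  also have "(2 powr p) powr (1 / p) = (2::real)"
    using p by (simp add: powr_powr)
  also have "2 * (2 powr (1 / p) * max (?v n) (?v m) powr (1 / p))
      \<le> 2 * (2 powr 1 * (?v n powr (1 / p) + ?v m powr (1 / p)))"
    using p by (intro mult_left_mono mult_mono powr_mono) (auto simp: max_def)
  finally show ?thesis by (simp add: Lp_norm_def)
qed

lemma z_step: "is_cond_exp M (filt M \<theta> F0 (int (k * 2 ^ Suc j)))
  (\<lambda>\<omega>. z \<omega> j (2 * k + 1)) (\<lambda>\<omega>. z \<omega> (Suc j) k - z \<omega> j (2 * k))"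
proof -
  have 1: "(2 * k + 1) * 2 ^ j = 2 ^ j + k * 2 ^ Suc j" "2 * k * 2 ^ j = k * 2 ^ Suc j" "2 ^ Suc j = 2 ^ j + (2 ^ j :: nat)"
    by (simp_all add: algebra_simps)
  show ?thesis
    using is_cond_exp_shift[OF cond_exp_Y_shift[of "2 ^ j" "2 ^ j"], of "k * 2 ^ Suc j"]
    unfolding z_def 1(1,2) funpow_add o_def 1(3) .
qed

lemma ident_z: "ident_adapted M p (\<lambda>k. filt M \<theta> F0 (int (k * 2 ^ Suc j)))
  (\<lambda>k \<omega>. z \<omega> j (2 * k + 1)) (\<lambda>k \<omega>. z \<omega> (Suc j) k - z \<omega> j (2 * k))"
proof
  show "1 < p" "p < 2" by (fact p)+
  show "subalgebra M (filt M \<theta> F0 (int (k * 2 ^ Suc j)))" for k by (rule subalgebra_filt)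
  show "sets (filt M \<theta> F0 (int (k * 2 ^ Suc j))) \<subseteq> sets (filt M \<theta> F0 (int (l * 2 ^ Suc j)))" if "k \<le> l" for k l
    using that by (intro filt_mono mult_le_mono1)
  show "(\<lambda>\<omega>. z \<omega> j (2 * k + 1)) \<in> borel_measurable (filt M \<theta> F0 (int (Suc k * 2 ^ Suc j)))" for k
  proof (rule measurable_from_subalg)
    show "(\<lambda>\<omega>. z \<omega> j (2 * k + 1)) \<in> borel_measurable (filt M \<theta> F0 (int ((2 * k + 1) * 2 ^ j)))"
      unfolding z_def by (rule measurable_shift[OF Y_F0])
    \<comment> \<open>Odd block 2 k + 1 is conditioned on the past of its own start, which precedes
      the next sampling time (k + 1) 2^(j+1); hence adaptedness.\<close>
    have "(2 * k + 1) * 2 ^ j \<le> Suc k * 2 ^ Suc j" by simp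
    from filt_mono[OF this]
    show "subalgebra (filt M \<theta> F0 (int (Suc k * 2 ^ Suc j))) (filt M \<theta> F0 (int ((2 * k + 1) * 2 ^ j)))"
      unfolding subalgebra_def space_filt by blast
  qed
  show "is_cond_exp M (filt M \<theta> F0 (int (k * 2 ^ Suc j))) (\<lambda>\<omega>. z \<omega> j (2 * k + 1))
    (\<lambda>\<omega>. z \<omega> (Suc j) k - z \<omega> j (2 * k))" for k by (rule z_step)
  show "distr M borel (\<lambda>\<omega>. norm (z \<omega> j (2 * k + 1))) = distr M borel (\<lambda>\<omega>. norm (z \<omega> j (2 * 0 + 1)))" for k
    unfolding z_def by (simp only: distr_shift[of "\<lambda>\<omega>. norm (Y (2 ^ j) \<omega>)"] measurable_compose[OF Y_meas borel_measurable_norm])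
  show "integrable M (\<lambda>\<omega>. norm (z \<omega> j (2 * 0 + 1)) powr p)"
    unfolding z_def by (rule integrable_shift[OF Y_Lp])
qed

text \<open>With the constant filtration \<open>M\<close> each variable is its own conditional
  expectation. The centered sums are then trivial, and the instance serves for the bounds on single
  variables.\<close>

lemma ident_z_all: "ident_adapted M p (\<lambda>_. M) (\<lambda>k \<omega>. z \<omega> j k) (\<lambda>k \<omega>. z \<omega> j k)"
proof
  have z_meas: "(\<lambda>\<omega>. z \<omega> j k) \<in> borel_measurable M" for k
    unfolding z_def by (rule measurable_compose[OF measurable_funpow Y_meas])
  then show "(\<lambda>\<omega>. z \<omega> j k) \<in> borel_measurable M" for k .
  have z_Lp: "integrable M (\<lambda>\<omega>. norm (z \<omega> j k) powr p)" for k
    unfolding z_def by (rule integrable_shift[OF Y_Lp])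
  then show "integrable M (\<lambda>\<omega>. norm (z \<omega> j 0) powr p)" .
  show "is_cond_exp M M (\<lambda>\<omega>. z \<omega> j k) (\<lambda>\<omega>. z \<omega> j k)" for k
    using p by (intro is_cond_exp_self integrable_of_powr[OF _ z_meas z_Lp] z_meas) simp
  show "distr M borel (\<lambda>\<omega>. norm (z \<omega> j k)) = distr M borel (\<lambda>\<omega>. norm (z \<omega> j 0))" for k
    unfolding z_def by (simp only: distr_shift[of "\<lambda>\<omega>. norm (Y (2 ^ j) \<omega>)"] measurable_compose[OF Y_meas borel_measurable_norm])
qed (use p in \<open>auto simp: subalgebra_def\<close>)

text \<open>\<open>z \<omega> 0 k\<close> is the conditional expectation of the (k + 1)-st variable
  given the time k, so the sum minus its level 0 compensator is a martingale: the bottom of the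
  decomposition.\<close>

lemma ident_x: "ident_adapted M p (\<lambda>k. filt M \<theta> F0 (int k))
  (\<lambda>k \<omega>. x ((\<theta> ^^ Suc k) \<omega>)) (\<lambda>k \<omega>. z \<omega> 0 k)"
proof
  show "1 < p" "p < 2" by (fact p)+
  show "subalgebra M (filt M \<theta> F0 (int k))" for k by (rule subalgebra_filt)
  show "sets (filt M \<theta> F0 (int k)) \<subseteq> sets (filt M \<theta> F0 (int l))" if "k \<le> l" for k l
    using that by (rule filt_mono)
  show "(\<lambda>\<omega>. x ((\<theta> ^^ Suc k) \<omega>)) \<in> borel_measurable (filt M \<theta> F0 (int (Suc k)))" for k
    by (rule measurable_shift[OF x_F0])
  show "is_cond_exp M (filt M \<theta> F0 (int k)) (\<lambda>\<omega>. x ((\<theta> ^^ Suc k) \<omega>)) (\<lambda>\<omega>. z \<omega> 0 k)" for k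
    using is_cond_exp_shift[OF cond_exp_Y[of 1], of k] by (simp add: z_def S_def)
  show "distr M borel (\<lambda>\<omega>. norm (x ((\<theta> ^^ Suc k) \<omega>))) = distr M borel (\<lambda>\<omega>. norm (x ((\<theta> ^^ Suc 0) \<omega>)))" for k
    by (simp only: distr_shift[of "\<lambda>\<omega>. norm (x \<omega>)"] measurable_compose[OF x_meas borel_measurable_norm])
  show "integrable M (\<lambda>\<omega>. norm (x ((\<theta> ^^ Suc 0) \<omega>)) powr p)"
    by (rule integrable_shift[OF x_Lp])
qed

end

section \<open>From square root growth to the almost sure rate\<close>

context adapted_process
begin

lemma z_meas [measurable]: "(\<lambda>\<omega>. z \<omega> j k) \<in> borel_measurable M"
  unfolding z_def by (rule measurable_compose[OF measurable_funpow Y_meas])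

lemma expectation_z: "(\<integral>\<omega>. norm (z \<omega> j k) powr p \<partial>M) = Lp_norm M p (Y (2 ^ j)) powr p"
proof -
  have "(\<integral>\<omega>. norm (z \<omega> j k) powr p \<partial>M) = (\<integral>\<omega>. norm (Y (2 ^ j) \<omega>) powr p \<partial>M)"
    unfolding z_def by (rule integral_shift[of "\<lambda>\<omega>. norm (Y (2 ^ j) \<omega>) powr p"]) measurable
  also have "\<dots> = Lp_norm M p (Y (2 ^ j)) powr p"
    using p by (simp add: Lp_norm_def powr_powr)
  finally show ?thesis .
qed

lemma AE_sum_tendsto_0:
  assumes C: "0 \<le> C" and growth: "\<And>n. 1 \<le> n \<Longrightarrow> Lp_norm M p (Y n) \<le> C * real n powr (1 / 2)"
  shows "AE \<omega> in M. (\<lambda>n. norm (S n \<omega>) / real n powr (1 / p)) \<longlonglongrightarrow> 0"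
proof -
  \<comment> \<open>Half of the gap between 1/p and 1/2. The threshold for level j is 2^(j (1/p -
    \<delta>)), which leaves \<rho> < 1; the moments are of order 2^(j p / 2), so their ratio to the
    p-th power of the threshold is of order 2^(-j p \<delta>) = r^j.\<close>
  define \<delta> where "\<delta> = (1 / p - 1 / 2) / 2"
  define \<rho> where "\<rho> = 2 powr (- \<delta>)"
  define \<tau> where "\<tau> j = (2 ^ j) powr (1 / p) * \<rho> ^ j" for j :: nat
  define r where "r = 2 powr (- (p * \<delta>))"
  have \<delta>: "0 < \<delta>" using p by (simp add: \<delta>_def field_simps)
  have \<rho>: "0 < \<rho>" "\<rho> < 1" using \<delta> powr_less_mono[of "- \<delta>" 0 "2::real"] by (auto simp: \<rho>_def)
  have r: "0 < r" "r < 1"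
    using \<delta> p powr_less_mono[of "- (p * \<delta>)" 0 "2::real"] by (auto simp: r_def)
  have \<tau>: "0 < \<tau> j" for j using \<rho> by (simp add: \<tau>_def)
  have two: "(2::real) ^ j = 2 powr real j" for j by (simp add: powr_realpow)
  have \<tau>_eq: "\<tau> j = 2 powr (real j * (1 / p - \<delta>))" for j
  proof -
    have "\<rho> ^ j = 2 powr (- \<delta> * real j)"
      using \<rho>(1) by (simp only: powr_realpow[symmetric] \<rho>_def powr_powr)
    then show ?thesis
      unfolding \<tau>_def two powr_powr by (simp only: powr_add[symmetric]) (simp add: algebra_simps)
  qed
  have moment: "trunc_const p * (\<integral>\<omega>. norm (z \<omega> j k) powr p \<partial>M) / \<tau> j powr p
      \<le> trunc_const p * C powr p * r ^ j" for j k
  proof -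
    have "Lp_norm M p (Y (2 ^ j)) powr p \<le> (C * real (2 ^ j) powr (1 / 2)) powr p"
      using p growth[of "2 ^ j"] by (intro powr_mono2) (auto simp: Lp_norm_def)
    also have "\<dots> = C powr p * 2 powr (real j * (1 / 2) * p)"
      using C by (simp add: powr_mult two powr_powr)
    finally have "(\<integral>\<omega>. norm (z \<omega> j k) powr p \<partial>M) / \<tau> j powr p
        \<le> C powr p * 2 powr (real j * (1 / 2) * p) / \<tau> j powr p"
      unfolding expectation_z by (intro divide_right_mono) auto
    also have "\<dots> = C powr p * 2 powr (real j * (1 / 2) * p - real j * (1 / p - \<delta>) * p)"
      unfolding \<tau>_eq powr_powr by (simp only: powr_diff times_divide_eq_right)
    also have "real j * (1 / 2) * p - real j * (1 / p - \<delta>) * p = - (p * \<delta>) * real j"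
      using p by (simp add: \<delta>_def field_simps)
    also have "2 powr (- (p * \<delta>) * real j) = r ^ j"
      using r(1) by (simp only: powr_realpow[symmetric] r_def powr_powr)
    finally have "(\<integral>\<omega>. norm (z \<omega> j k) powr p \<partial>M) / \<tau> j powr p \<le> C powr p * r ^ j" .
    from mult_left_mono[OF this trunc_const_nonneg[OF p]] show ?thesis
      by (simp only: times_divide_eq_right mult.assoc)
  qed
  \<comment> \<open>The probabilities form a geometric series in j, so almost surely only finitely
    many levels violate their bound.\<close>
  have ev: "AE \<omega> in M. \<forall>\<^sub>F j in sequentially. \<omega> \<in> space M - A j"
    if "\<And>j. A j \<in> events" "\<And>j. prob (A j) \<le> trunc_const p * C powr p * r ^ j" for A
  proof (rule borel_cantelli_AE1)
    show "summable (\<lambda>j. prob (A j))"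
    proof (rule summable_comparison_test')
      show "summable (\<lambda>j. trunc_const p * C powr p * r ^ j)"
        using r by (intro summable_mult summable_geometric) auto
    qed (use that in auto)
  qed (use that in \<open>auto simp: emeasure_eq_measure\<close>)
  have bound1: "AE \<omega> in M. \<forall>\<^sub>F j in sequentially. \<omega> \<in> space M -
      {\<omega>\<in>space M. \<exists>m. 4 * \<tau> j * real (Suc m) powr (1 / p) < norm (level_sum (z \<omega>) j m)}"
  proof (rule ev)
    show "{\<omega>\<in>space M. \<exists>m. 4 * \<tau> j * real (Suc m) powr (1 / p) < norm (level_sum (z \<omega>) j m)} \<in> events" for j
      unfolding level_sum_def by measurable
    show "prob {\<omega>\<in>space M. \<exists>m. 4 * \<tau> j * real (Suc m) powr (1 / p) < norm (level_sum (z \<omega>) j m)}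
        \<le> trunc_const p * C powr p * r ^ j" for j
      unfolding level_sum_def
      by (rule order_trans[OF ident_adapted.prob_centered_sum_le[OF ident_z \<tau>] moment])
  qed
  have bound2: "AE \<omega> in M. \<forall>\<^sub>F j in sequentially. \<omega> \<in> space M -
      {\<omega>\<in>space M. \<exists>m. \<tau> j * real (Suc m) powr (1 / p) < norm (z \<omega> j m)}"
  proof (rule ev)
    show "{\<omega>\<in>space M. \<exists>m. \<tau> j * real (Suc m) powr (1 / p) < norm (z \<omega> j m)} \<in> events" for j
      by measurable
    show "prob {\<omega>\<in>space M. \<exists>m. \<tau> j * real (Suc m) powr (1 / p) < norm (z \<omega> j m)}
        \<le> trunc_const p * C powr p * r ^ j" for j
      by (rule order_trans[OF ident_adapted.prob_Ex_norm_Z_le[OF ident_z_all \<tau>] moment])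
  qed
  have lim1: "AE \<omega> in M. \<forall>j. (\<lambda>m. norm (level_sum (z \<omega>) j m) / real (Suc m) powr (1 / p)) \<longlonglongrightarrow> 0"
    unfolding AE_all_countable level_sum_def
    by (intro allI ident_adapted.AE_centered_sum_tendsto_0[OF ident_z])
  have lim2: "AE \<omega> in M. \<forall>j. (\<lambda>m. norm (z \<omega> j m) / real (Suc m) powr (1 / p)) \<longlonglongrightarrow> 0"
    unfolding AE_all_countable
    by (intro allI ident_adapted.AE_norm_Z_tendsto_0[OF ident_z_all])
  have lim0: "AE \<omega> in M. (\<lambda>m. norm (\<Sum>k<m. x ((\<theta> ^^ Suc k) \<omega>) - z \<omega> 0 k) / real (Suc m) powr (1 / p)) \<longlonglongrightarrow> 0"
    by (rule ident_adapted.AE_centered_sum_tendsto_0[OF ident_x])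
  from bound1 bound2 lim1 lim2 lim0 show ?thesis
  proof eventually_elim
    case (elim \<omega>)
    have "\<forall>\<^sub>F j in sequentially. \<forall>m. norm (level_sum (z \<omega>) j m)
      \<le> 4 * (2 ^ j) powr (1 / p) * \<rho> ^ j * real (Suc m) powr (1 / p)"
      using elim(1) by eventually_elim (auto simp: \<tau>_def not_less mult.assoc)
    moreover have "\<forall>\<^sub>F j in sequentially. \<forall>m. norm (z \<omega> j m)
      \<le> 4 * (2 ^ j) powr (1 / p) * \<rho> ^ j * real (Suc m) powr (1 / p)"
      using elim(2)
    proof eventually_elim
      case (elim j)
      show ?case
      proof
        fix m
        have "norm (z \<omega> j m) \<le> \<tau> j * real (Suc m) powr (1 / p)"
          using elim by (auto simp: not_less)
        also have "\<dots> \<le> 4 * (\<tau> j * real (Suc m) powr (1 / p))"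
          using \<tau>[of j] by simp
        finally show "norm (z \<omega> j m) \<le> 4 * (2 ^ j) powr (1 / p) * \<rho> ^ j * real (Suc m) powr (1 / p)"
          by (simp add: \<tau>_def mult.assoc)
      qed
    qed
    \<comment> \<open>The 4 is that of the maximal inequality; single blocks satisfy the bound
      already with 1.\<close>
    ultimately have "(\<lambda>n. norm (\<Sum>k<n. z \<omega> 0 k) / real n powr (1 / p)) \<longlonglongrightarrow> 0"
      using \<rho> p elim(3,4) by (intro level_sums_tendsto_0[where \<rho> = \<rho> and K = 4]) auto
    \<comment> \<open>The strong law is normalised by (n + 1)^(1/p). Passing to n^(1/p) costs
      2^(1/p) \<le> 2 for n \<ge> 1.\<close>
    with elim(5) have lim: "(\<lambda>n. 2 * (norm (\<Sum>k<n. x ((\<theta> ^^ Suc k) \<omega>) - z \<omega> 0 k) / real (Suc n) powr (1 / p))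
        + norm (\<Sum>k<n. z \<omega> 0 k) / real n powr (1 / p)) \<longlonglongrightarrow> 2 * 0 + 0"
      by (intro tendsto_add tendsto_mult tendsto_const)
    show ?case
    proof (rule Lim_null_comparison)
      show "(\<lambda>n. 2 * (norm (\<Sum>k<n. x ((\<theta> ^^ Suc k) \<omega>) - z \<omega> 0 k) / real (Suc n) powr (1 / p))
        + norm (\<Sum>k<n. z \<omega> 0 k) / real n powr (1 / p)) \<longlonglongrightarrow> 0" using lim by simp
      show "\<forall>\<^sub>F n in sequentially. norm (norm (S n \<omega>) / real n powr (1 / p))
        \<le> 2 * (norm (\<Sum>k<n. x ((\<theta> ^^ Suc k) \<omega>) - z \<omega> 0 k) / real (Suc n) powr (1 / p))
        + norm (\<Sum>k<n. z \<omega> 0 k) / real n powr (1 / p)"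
        using eventually_ge_at_top[of 1]
      proof eventually_elim
        case (elim n)
        let ?a = "norm (\<Sum>k<n. x ((\<theta> ^^ Suc k) \<omega>) - z \<omega> 0 k)"
        have "S n \<omega> = (\<Sum>k<n. x ((\<theta> ^^ Suc k) \<omega>) - z \<omega> 0 k) + (\<Sum>k<n. z \<omega> 0 k)"
          unfolding S_def sum.distrib[symmetric] by (intro sum.cong) auto
        then have "norm (S n \<omega>) \<le> ?a + norm (\<Sum>k<n. z \<omega> 0 k)"
          by (simp only: norm_triangle_ineq)
        then have "norm (S n \<omega>) / real n powr (1 / p)
            \<le> ?a / real n powr (1 / p) + norm (\<Sum>k<n. z \<omega> 0 k) / real n powr (1 / p)"
          unfolding add_divide_distrib[symmetric] by (intro divide_right_mono) auto
        moreover have "?a / real n powr (1 / p) \<le> 2 * (?a / real (Suc n) powr (1 / p))"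
        proof -
          have "real (Suc n) powr (1 / p) \<le> (2 * real n) powr (1 / p)"
            using elim p by (intro powr_mono2) auto
          also have "\<dots> = 2 powr (1 / p) * real n powr (1 / p)" by (simp add: powr_mult)
          also have "\<dots> \<le> 2 * real n powr (1 / p)"
            using p powr_mono[of "1 / p" 1 "2::real"] by (intro mult_right_mono) auto
          finally have "?a * real (Suc n) powr (1 / p) \<le> ?a * (2 * real n powr (1 / p))"
            by (rule mult_left_mono) simp
          then show ?thesis using elim by (simp add: field_simps)
        qed
        ultimately show ?case by simp
      qed
    qed
  qed
qed

end

section \<open>Transfer to the given sequence\<close>

theorem theorem3p1:
  fixes M :: "'a measure" and \<theta> :: "'a \<Rightarrow> 'a" and F0 :: "'a measure"
    and X :: "int \<Rightarrow> 'a \<Rightarrow> 'h :: {real_inner, banach, second_countable_topology}"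
    and p :: real
  assumes "stationary_setting M \<theta> F0"
    and "1 < p" and "p < 2"
    and "adapted_stationary_seq M \<theta> F0 p X"
    and "(\<lambda>n::nat. ln (real n) *
            (Lp_norm M p (cond_exp M (filt M \<theta> F0 0) (partial_sum X n)) / real n powr (3 / 2)))
          summable_on {2..}"
  shows "(\<exists>Mart :: nat \<Rightarrow> 'a \<Rightarrow> 'h. stationary_martingale M \<theta> F0 p Mart \<and>
            (AE \<omega> in M. (\<lambda>n. norm (partial_sum X n \<omega> - Mart n \<omega>)) \<in> o(\<lambda>n. real n powr (1 / p)))) \<and>
         (AE \<omega> in M. (\<lambda>n. norm (partial_sum X n \<omega>)) \<in> o(\<lambda>n. real n powr (1 / p)))"
proof -
  interpret stationary_setting M \<theta> F0 by fact
  have X0: "X 0 \<in> borel_measurable F0" "integrable M (\<lambda>\<omega>. norm (X 0 \<omega>) powr p)"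
    using assms(4) by (auto simp: adapted_stationary_seq_def in_Lp_def)
  interpret adapted_process M \<theta> F0 p "X 0"
    using assms(2,3) X0 by unfold_locales
  have S_eq: "partial_sum X n \<omega> = S n \<omega>" if "\<omega> \<in> space M" for n \<omega>
  proof -
    have "X (int k) \<omega> = X 0 ((\<theta> ^^ k) \<omega>)" for k
      using assms(4) that by (simp add: adapted_stationary_seq_def iterate_int)
    then show ?thesis
      unfolding partial_sum_def S_def by (simp only: One_nat_def sum.atLeast1_atMost_eq)
  qed
  \<comment> \<open>The two sums agree only on \<open>space M\<close>, but \<open>cond_exp\<close>
    depends on its argument solely through this predicate, so the chosen versions are equal as
    functions.\<close>
  have "is_cond_exp M F (partial_sum X n) = is_cond_exp M F (S n)" for F n
    using is_cond_exp_cong[of M "partial_sum X n" "S n" F] S_eq by (simp add: fun_eq_iff)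
  then have Y_eq: "cond_exp M (filt M \<theta> F0 0) (partial_sum X n) = Y n" for n
    by (simp add: cond_exp_def Y_def)
  obtain C where C: "0 \<le> C" "\<And>n. 1 \<le> n \<Longrightarrow> Lp_norm M p (Y n) \<le> C * real n powr (1 / 2)"
  proof (rule sqrt_growth_if_quasi_subadditive)
    show "(\<lambda>n. ln (real n) * (Lp_norm M p (Y n) / real n powr (3 / 2))) summable_on {2..}"
      using assms(5) by (simp only: Y_eq)
    show "Lp_norm M p (Y (n + m)) \<le> 4 * (Lp_norm M p (Y n) + Lp_norm M p (Y m))" for n m
      by (rule Lp_norm_Y_add_le)
  qed (auto simp: Lp_norm_def)
  have lim: "AE \<omega> in M. (\<lambda>n. norm (S n \<omega>) / real n powr (1 / p)) \<longlonglongrightarrow> 0"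
    by (rule AE_sum_tendsto_0[OF C])
  have main: "AE \<omega> in M. (\<lambda>n. norm (partial_sum X n \<omega>)) \<in> o(\<lambda>n. real n powr (1 / p))"
    using lim AE_space
  proof eventually_elim
    case (elim \<omega>)
    show ?case
    proof (rule smalloI_tendsto)
      show "((\<lambda>n. norm (partial_sum X n \<omega>) / real n powr (1 / p)) \<longlongrightarrow> 0) sequentially"
        using elim by (simp add: S_eq)
      show "\<forall>\<^sub>F n in sequentially. real n powr (1 / p) \<noteq> 0"
        using eventually_gt_at_top[of 0] by eventually_elim simp
    qed
  qed
  moreover have "stationary_martingale M \<theta> F0 p (\<lambda>_ _. 0 :: 'h)"
    unfolding stationary_martingale_def
    by (intro exI[of _ "\<lambda>_ _. 0"] conjI zero_stationary_mart_diff) (simp add: partial_sum_def)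
  ultimately show ?thesis
    by (intro conjI exI[of _ "\<lambda>_ _. 0"]) simp_all
qed

end
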